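(* Let $\theta\in(0,\pi/4]$, let $|\psi(\theta)\rangle_{AB}=\cos\theta|00\rangle+\sin\theta|11\rangle$, and let $|\Phi\rangle_{A'B'K}=\alpha|000\rangle+\beta|111\rangle$ with real $\alpha\ge\beta>0$, $\alpha^2+\beta^2=1$. Set $$P_{\max}^{\rm GHZ}(\theta,\alpha)=\min\bigl(1,\,2(1-\alpha^2\cos^2\theta)\bigr).$$ (i) In the Bank-measures model, with the Bank measuring $K$ in the basis $\{|+\rangle,|-\rangle\}$ and broadcasting the outcome, the optimal probability (over LOCC protocols of Alice and Bob across $AA'\mid BB'$) of restoring a Bell pair on $AB$ is $P_{\max}^{\rm GHZ}(\theta,\alpha)$ in each branch. (ii) In the transfer model, the optimal probability (over LOCC protocols of Alice and Bob across $AA'K\mid BB'$) of restoring a Bell pair on $AB$ is also $P_{\max}^{\rm GHZ}(\theta,\alpha)$.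
   Context: All registers $A,B,A',B',K$ are qubits. The global initial state is $|\psi(\theta)\rangle_{AB}\otimes|\Phi\rangle_{A'B'K}$. Alice holds $A,A'$; Bob holds $B,B'$; the Bank holds $K$; $|\pm\rangle=\frac{1}{\sqrt2}(|0\rangle\pm|1\rangle)$. LOCC means local quantum operations by Alice and Bob (local ancillas and discarding of systems allowed) with finitely many rounds of classical communication between them. Bank-measures model: the Bank measures $K$ and broadcasts the classical outcome; afterwards Alice (on $AA'$) and Bob (on $BB'$) act by LOCC, which may depend on the outcome. Transfer model: the Bank hands $K$ to Alice and is then absent; Alice (holding $AA'K$) and Bob (holding $BB'$) act by LOCC. The probability with which an LOCC protocol restores a Bell pair on $AB$ is the total probability of those (classically known) outcomes of the protocol for which the final state of registers $A$ and $B$ is exactly $|\Phi^+\rangle=\frac{1}{\sqrt2}(|00\rangle+|11\rangle)$, the other registers being left in any state. The optimal probability is the maximum over LOCC protocols. *)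

theory Defs
  imports Complex_Main "Jordan_Normal_Form.Matrix" "Jordan_Normal_Form.Schur_Decomposition"
begin

section \<open>Matrix preliminaries\<close>

definition kron :: "complex mat \<Rightarrow> complex mat \<Rightarrow> complex mat" where
  "kron M N = mat (dim_row M * dim_row N) (dim_col M * dim_col N)
     (\<lambda>(i, j). M $$ (i div dim_row N, j div dim_col N) * N $$ (i mod dim_row N, j mod dim_col N))"

definition tr :: "complex mat \<Rightarrow> complex" where
  "tr M = (\<Sum>i<dim_row M. M $$ (i, i))"

definition ketbra :: "complex vec \<Rightarrow> complex mat" where
  "ketbra v = mat (dim_vec v) (dim_vec v) (\<lambda>(i, j). v $ i * cnj (v $ j))"

definition msum :: "nat \<Rightarrow> complex mat list \<Rightarrow> complex mat" where
  "msum d Ms = foldr (+) Ms (0\<^sub>m d d)"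

section \<open>LOCC protocols\<close>

text \<open>
  Alice's local space is \<open>\<complex>\<^sup>2 \<otimes> \<complex>\<^sup>a\<close> and Bob's is \<open>\<complex>\<^sup>2 \<otimes> \<complex>\<^sup>b\<close>: the qubit factors are the registers
  \<open>A\<close> and \<open>B\<close>, and \<open>a\<close>, \<open>b\<close> are the dimensions of everything else the party holds at that moment.
  The joint space has dimension \<open>(2 * a) * (2 * b)\<close>, with Alice's factor most significant.

  A local operation is a quantum instrument with finitely many outcomes. Outcome \<open>j < n\<close> is the
  completely positive map with Kraus operators \<open>E j\<close>, after which the party's remaining
  registers have dimension \<open>d j\<close>. Since \<open>d j\<close> is arbitrary, local ancillas may be added and
  systems discarded (the Kraus index within one outcome is not recorded). The outcome is
  announced, and the protocol goes on with \<open>C j\<close>; values at indices \<open>j \<ge> n\<close> are irrelevant.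
\<close>

datatype locc =
    Finish
  | Alice nat "nat \<Rightarrow> nat" "nat \<Rightarrow> complex mat list" "nat \<Rightarrow> locc"
  | Bob nat "nat \<Rightarrow> nat" "nat \<Rightarrow> complex mat list" "nat \<Rightarrow> locc"

definition instrument ::
    "nat \<Rightarrow> nat \<Rightarrow> (nat \<Rightarrow> nat) \<Rightarrow> (nat \<Rightarrow> complex mat list) \<Rightarrow> bool" where
  "instrument c n d E \<longleftrightarrow>
     (\<forall>j<n. 0 < d j \<and> set (E j) \<subseteq> carrier_mat (2 * d j) (2 * c)) \<and>
     msum (2 * c) (map (\<lambda>K. mat_adjoint K * K) (concat (map E [0..<n]))) = 1\<^sub>m (2 * c)"

primrec locc_protocol :: "locc \<Rightarrow> nat \<Rightarrow> nat \<Rightarrow> bool" where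
  "locc_protocol Finish a b \<longleftrightarrow> True"
| "locc_protocol (Alice n d E C) a b \<longleftrightarrow>
     instrument a n d E \<and> (\<forall>j<n. locc_protocol (C j) (d j) b)"
| "locc_protocol (Bob n d E C) a b \<longleftrightarrow>
     instrument b n d E \<and> (\<forall>j<n. locc_protocol (C j) a (d j))"

definition apply_kraus :: "nat \<Rightarrow> complex mat list \<Rightarrow> complex mat \<Rightarrow> complex mat" where
  "apply_kraus d Ks \<rho> = msum d (map (\<lambda>K. K * \<rho> * mat_adjoint K) Ks)"

definition apply_Alice :: "nat \<Rightarrow> nat \<Rightarrow> complex mat list \<Rightarrow> complex mat \<Rightarrow> complex mat" where
  "apply_Alice a' b Ks = apply_kraus ((2 * a') * (2 * b)) (map (\<lambda>K. kron K (1\<^sub>m (2 * b))) Ks)"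

definition apply_Bob :: "nat \<Rightarrow> nat \<Rightarrow> complex mat list \<Rightarrow> complex mat \<Rightarrow> complex mat" where
  "apply_Bob a b' Ks = apply_kraus ((2 * a) * (2 * b')) (map (\<lambda>K. kron (1\<^sub>m (2 * a)) K) Ks)"

text \<open>Partial trace over all registers other than \<open>A\<close> and \<open>B\<close>.\<close>

definition reduced_AB :: "nat \<Rightarrow> nat \<Rightarrow> complex mat \<Rightarrow> complex mat" where
  "reduced_AB a b \<rho> = mat 4 4 (\<lambda>(i, j). \<Sum>r<a. \<Sum>s<b.
     \<rho> $$ (((i div 2) * a + r) * (2 * b) + ((i mod 2) * b + s),
           ((j div 2) * a + r) * (2 * b) + ((j mod 2) * b + s)))"

definition bell_ket :: "complex vec" where
  "bell_ket = vec_of_list [complex_of_real (1 / sqrt 2), 0, 0, complex_of_real (1 / sqrt 2)]"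

definition bell_restored :: "nat \<Rightarrow> nat \<Rightarrow> complex mat \<Rightarrow> bool" where
  "bell_restored a b \<rho> \<longleftrightarrow> tr \<rho> \<noteq> 0 \<and> reduced_AB a b (inverse (tr \<rho>) \<cdot>\<^sub>m \<rho>) = ketbra bell_ket"

text \<open>
  States are propagated without renormalisation, so the trace of the state at a leaf
  is the probability of the corresponding sequence of outcomes.
\<close>

primrec success_prob :: "locc \<Rightarrow> nat \<Rightarrow> nat \<Rightarrow> complex mat \<Rightarrow> real" where
  "success_prob Finish a b \<rho> = (if bell_restored a b \<rho> then Re (tr \<rho>) else 0)"
| "success_prob (Alice n d E C) a b \<rho> =
     (\<Sum>j<n. success_prob (C j) (d j) b (apply_Alice (d j) b (E j) \<rho>))"
| "success_prob (Bob n d E C) a b \<rho> =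
     (\<Sum>j<n. success_prob (C j) a (d j) (apply_Bob a (d j) (E j) \<rho>))"

definition optimal_success_prob :: "nat \<Rightarrow> nat \<Rightarrow> complex mat \<Rightarrow> real \<Rightarrow> bool" where
  "optimal_success_prob a b \<rho> p \<longleftrightarrow>
     (\<exists>P. locc_protocol P a b \<and> success_prob P a b \<rho> = p) \<and>
     (\<forall>P. locc_protocol P a b \<longrightarrow> success_prob P a b \<rho> \<le> p)"

section \<open>The two models\<close>

definition psi_ket :: "real \<Rightarrow> complex vec" where
  "psi_ket \<theta> = vec_of_list [complex_of_real (cos \<theta>), 0, 0, complex_of_real (sin \<theta>)]"

definition ghz_ket :: "real \<Rightarrow> real \<Rightarrow> complex vec" where
  "ghz_ket \<alpha> \<beta> = vec_of_list [complex_of_real \<alpha>, 0, 0, 0, 0, 0, 0, complex_of_real \<beta>]"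

text \<open>
  Amplitude of \<open>|\<psi>(\<theta>)\<rangle>\<close> on \<open>AB\<close> tensor \<open>|\<Phi>\<rangle>\<close> on \<open>A'B'K\<close>, at the basis
  state where \<open>A, B, A', B', K\<close> carry the bits \<open>x, y, x', y', k\<close>.
\<close>

definition initial_amp ::
    "real \<Rightarrow> real \<Rightarrow> real \<Rightarrow> nat \<Rightarrow> nat \<Rightarrow> nat \<Rightarrow> nat \<Rightarrow> nat \<Rightarrow> complex" where
  "initial_amp \<theta> \<alpha> \<beta> x y x' y' k = psi_ket \<theta> $ (2 * x + y) * ghz_ket \<alpha> \<beta> $ (4 * x' + 2 * y' + k)"

definition binary_digit :: "nat \<Rightarrow> nat \<Rightarrow> nat" where
  "binary_digit i m = i div 2 ^ m mod 2"

text \<open>Registers ordered \<open>A A' K | B B'\<close>, so \<open>a = 4\<close> and \<open>b = 2\<close>.\<close>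

definition transfer_ket :: "real \<Rightarrow> real \<Rightarrow> real \<Rightarrow> complex vec" where
  "transfer_ket \<theta> \<alpha> \<beta> = vec 32 (\<lambda>i. initial_amp \<theta> \<alpha> \<beta>
     (binary_digit i 4) (binary_digit i 1) (binary_digit i 3) (binary_digit i 0) (binary_digit i 2))"

definition transfer_state :: "real \<Rightarrow> real \<Rightarrow> real \<Rightarrow> complex mat" where
  "transfer_state \<theta> \<alpha> \<beta> = ketbra (transfer_ket \<theta> \<alpha> \<beta>)"

definition plus_ket :: "complex vec" where
  "plus_ket = vec_of_list [complex_of_real (1 / sqrt 2), complex_of_real (1 / sqrt 2)]"

definition minus_ket :: "complex vec" where
  "minus_ket = vec_of_list [complex_of_real (1 / sqrt 2), - complex_of_real (1 / sqrt 2)]"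

text \<open>
  The unnormalised branch \<open>\<langle>\<kappa>|\<^sub>K\<close> applied to the initial state, registers ordered
  \<open>A A' | B B'\<close> (so \<open>a = b = 2\<close>), and the state of Alice and Bob conditional on outcome \<open>\<kappa>\<close>.
\<close>

definition bank_ket :: "real \<Rightarrow> real \<Rightarrow> real \<Rightarrow> complex vec \<Rightarrow> complex vec" where
  "bank_ket \<theta> \<alpha> \<beta> \<kappa> = vec 16 (\<lambda>i. \<Sum>k<2. cnj (\<kappa> $ k) * initial_amp \<theta> \<alpha> \<beta>
     (binary_digit i 3) (binary_digit i 1) (binary_digit i 2) (binary_digit i 0) k)"

definition bank_state :: "real \<Rightarrow> real \<Rightarrow> real \<Rightarrow> complex vec \<Rightarrow> complex mat" where
  "bank_state \<theta> \<alpha> \<beta> \<kappa> =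
     inverse (tr (ketbra (bank_ket \<theta> \<alpha> \<beta> \<kappa>))) \<cdot>\<^sub>m ketbra (bank_ket \<theta> \<alpha> \<beta> \<kappa>)"

definition P_max_GHZ :: "real \<Rightarrow> real \<Rightarrow> real" where
  "P_max_GHZ \<theta> \<alpha> = min 1 (2 * (1 - \<alpha>\<^sup>2 * (cos \<theta>)\<^sup>2))"

end

(*
  Upper bound. Write the shared state as psi = u + w, where u is the term of the Schmidt
  decomposition with the largest coefficient. Every Kraus operator K of an LOCC protocol is a
  tensor product, so K u stays a product vector. If K psi = K u + K w is a Bell pair on AB tensor a
  junk vector, then a product vector being far from the Bell state forces
  |K psi|^2 <= 2 |K w|^2; summing over all successful Kraus operators, the completeness relation
  gives success probability at most 2 |w|^2 = 2 (1 - lambda_0). This avoids majorization and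
  entanglement monotones, and covers mixed states in the middle of the protocol.

  Attainment. Label the Schmidt indices 0, 1, 2, 3, so lambda_0 = alpha^2 cos^2 theta. Alice
  measures which pair {0,3}, {0,1}, {0,2} or {1,2} of Schmidt indices is used, leaving a maximally
  entangled state on that pair, with weights lambda_3, lambda_1 - w, lambda_2 - w, w where
  w = max 0 (1/2 - lambda_0); what is left of index 0 is the failure outcome. Both parties then map
  the pair to their qubit. In all three cases of the theorem the state has this Schmidt form.
*)
theory Submission
  imports Defs
begin

section \<open>Matrix and vector entries\<close>

lemma sum_lessThan_mult_split:
  fixes f :: "nat \<Rightarrow> 'a::comm_monoid_add"
  shows "(\<Sum>i<n * k. f i) = (\<Sum>p<n. \<Sum>q<k. f (p * k + q))"
proof -
  have "(\<Sum>i<n * k. f i) = (\<Sum>p<n. sum f {p * k..<p * k + k})"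
    by (rule sum.nat_group[symmetric])
  also have "\<dots> = (\<Sum>p<n. \<Sum>q<k. f (p * k + q))"
  proof (rule sum.cong[OF refl])
    fix p
    have "sum f {0 + p * k..<k + p * k} = (\<Sum>q = 0..<k. f (q + p * k))"
      by (rule sum.shift_bounds_nat_ivl)
    then show "sum f {p * k..<p * k + k} = (\<Sum>q<k. f (p * k + q))"
      by (simp add: atLeast0LessThan add.commute)
  qed
  finally show ?thesis .
qed

lemma mult_add_less:
  fixes i j n m :: nat
  assumes "i < n" "j < m"
  shows "i * m + j < n * m"
proof -
  have "i * m + j < Suc i * m" using assms by simp
  also have "\<dots> \<le> n * m" using assms by (intro mult_le_mono1) simp
  finally show ?thesis .
qed

lemma sum_sum_list_swap:
  fixes f :: "'a \<Rightarrow> 'b \<Rightarrow> 'c::comm_monoid_add"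
  shows "(\<Sum>i\<in>S. \<Sum>x\<leftarrow>xs. f i x) = (\<Sum>x\<leftarrow>xs. \<Sum>i\<in>S. f i x)"
  by (induction xs) (simp_all add: sum.distrib)

lemma sum_list_concat_map:
  fixes f :: "'a \<Rightarrow> 'b::comm_monoid_add"
  shows "(\<Sum>x\<leftarrow>concat (map g ys). f x) = (\<Sum>y\<leftarrow>ys. \<Sum>x\<leftarrow>g y. f x)"
  by (induction ys) simp_all

lemma msum_carrier:
  "set Ms \<subseteq> carrier_mat d d \<Longrightarrow> msum d Ms \<in> carrier_mat d d"
  by (induction Ms) (auto simp: msum_def)

lemma msum_index:
  assumes "set Ms \<subseteq> carrier_mat d d" "i < d" "j < d"
  shows "msum d Ms $$ (i, j) = (\<Sum>M\<leftarrow>Ms. M $$ (i, j))"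
  using assms
proof (induction Ms)
  case Nil
  then show ?case by (simp add: msum_def)
next
  case (Cons M Ms)
  then have "msum d Ms \<in> carrier_mat d d" by (intro msum_carrier) simp
  with Cons show ?case by (simp add: msum_def)
qed

lemma mat_adjoint_dim [simp]:
  "dim_row (mat_adjoint M) = dim_col M" "dim_col (mat_adjoint M) = dim_row M"
  by (simp_all add: mat_adjoint_def)

lemma mat_adjoint_index [simp]:
  fixes M :: "complex mat"
  assumes "i < dim_col M" "j < dim_row M"
  shows "mat_adjoint M $$ (i, j) = cnj (M $$ (j, i))"
  using assms by (simp add: mat_adjoint_def mat_of_rows_index conjugate_complex_def)

lemma mult_mat_vec_index:
  assumes "M \<in> carrier_mat n m" "v \<in> carrier_vec m" "i < n"
  shows "(M *\<^sub>v v) $ i = (\<Sum>j<m. M $$ (i, j) * v $ j)"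
  using assms by (simp add: scalar_prod_def atLeast0LessThan)

lemma adjoint_mult_index:
  fixes M :: "complex mat"
  assumes "M \<in> carrier_mat n m" "i < m" "j < m"
  shows "(mat_adjoint M * M) $$ (i, j) = (\<Sum>k<n. cnj (M $$ (k, i)) * M $$ (k, j))"
  using assms by (simp add: scalar_prod_def atLeast0LessThan)

lemma ketbra_carrier [simp]: "v \<in> carrier_vec n \<Longrightarrow> ketbra v \<in> carrier_mat n n"
  by (simp add: ketbra_def)

lemma ketbra_index: "v \<in> carrier_vec n \<Longrightarrow> i < n \<Longrightarrow> j < n \<Longrightarrow> ketbra v $$ (i, j) = v $ i * cnj (v $ j)"
  by (simp add: ketbra_def)

lemma sandwich_carrier:
  "K \<in> carrier_mat n m \<Longrightarrow> K * \<rho> * mat_adjoint K \<in> carrier_mat n n"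
  by (intro carrier_matI) auto

lemma sandwich_index:
  assumes K: "K \<in> carrier_mat n m" and R: "\<rho> \<in> carrier_mat m m" and ij: "i < n" "j < n"
  shows "(K * \<rho> * mat_adjoint K) $$ (i, j) =
    (\<Sum>l<m. (\<Sum>k<m. K $$ (i, k) * \<rho> $$ (k, l)) * cnj (K $$ (j, l)))"
  using assms by (simp add: scalar_prod_def atLeast0LessThan)

lemma kron_carrier:
  "M \<in> carrier_mat r c \<Longrightarrow> N \<in> carrier_mat r' c' \<Longrightarrow> kron M N \<in> carrier_mat (r * r') (c * c')"
  by (auto simp: kron_def)

lemma kron_index:
  assumes "M \<in> carrier_mat r c" "N \<in> carrier_mat r' c'" "i < r" "i' < r'" "j < c" "j' < c'"
  shows "kron M N $$ (i * r' + i', j * c' + j') = M $$ (i, j) * N $$ (i', j')"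
  using assms mult_add_less[of i r i' r'] mult_add_less[of j c j' c'] by (auto simp: kron_def)

lemma kron_mult_vec_index:
  assumes "M \<in> carrier_mat r c" "N \<in> carrier_mat r' c'" "v \<in> carrier_vec (c * c')" "i < r" "i' < r'"
  shows "(kron M N *\<^sub>v v) $ (i * r' + i') =
    (\<Sum>j<c. \<Sum>j'<c'. M $$ (i, j) * N $$ (i', j') * v $ (j * c' + j'))"
  unfolding mult_mat_vec_index[OF kron_carrier[OF assms(1,2)] assms(3) mult_add_less[OF assms(4,5)]]
    sum_lessThan_mult_split
  using assms by (intro sum.cong refl) (simp add: kron_index[OF assms(1,2)])

lemma kron_one_right_mult_vec_index:
  assumes "M \<in> carrier_mat r c" "v \<in> carrier_vec (c * m)" "i < r" "i' < m"
  shows "(kron M (1\<^sub>m m) *\<^sub>v v) $ (i * m + i') = (\<Sum>j<c. M $$ (i, j) * v $ (j * m + i'))"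
proof -
  have "(kron M (1\<^sub>m m) *\<^sub>v v) $ (i * m + i') =
    (\<Sum>j<c. \<Sum>j'<m. if j' = i' then M $$ (i, j) * v $ (j * m + j') else 0)"
    unfolding kron_mult_vec_index[OF assms(1) one_carrier_mat assms(2-4)]
    using assms by (intro sum.cong refl) auto
  then show ?thesis using assms by simp
qed

lemma kron_one_left_mult_vec_index:
  assumes "N \<in> carrier_mat r c" "v \<in> carrier_vec (m * c)" "i < m" "i' < r"
  shows "(kron (1\<^sub>m m) N *\<^sub>v v) $ (i * r + i') = (\<Sum>j<c. N $$ (i', j) * v $ (i * c + j))"
proof -
  have "(kron (1\<^sub>m m) N *\<^sub>v v) $ (i * r + i') =
    (\<Sum>j<m. if j = i then (\<Sum>j'<c. N $$ (i', j') * v $ (j * c + j')) else 0)"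
    unfolding kron_mult_vec_index[OF one_carrier_mat assms(1) assms(2-4)]
    using assms by (intro sum.cong refl) auto
  then show ?thesis using assms by simp
qed

section \<open>Unrecorded mixtures of vectors\<close>

definition sq_norm :: "complex vec \<Rightarrow> real" where
  "sq_norm v = (\<Sum>i<dim_vec v. (cmod (v $ i))\<^sup>2)"

text \<open>An unnormalised density operator is kept as an ensemble, one vector for each unrecorded
  Kraus path. Mixed states in the middle of a protocol can then be treated vector by vector.\<close>

definition mixture :: "nat \<Rightarrow> complex vec list \<Rightarrow> complex mat" where
  "mixture n vs = msum n (map ketbra vs)"

lemma mixture_carrier: "set vs \<subseteq> carrier_vec n \<Longrightarrow> mixture n vs \<in> carrier_mat n n"
  unfolding mixture_def by (intro msum_carrier) auto

lemma mixture_index: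
  assumes "set vs \<subseteq> carrier_vec n" "i < n" "j < n"
  shows "mixture n vs $$ (i, j) = (\<Sum>v\<leftarrow>vs. v $ i * cnj (v $ j))"
proof -
  have "mixture n vs $$ (i, j) = (\<Sum>v\<leftarrow>vs. ketbra v $$ (i, j))"
    unfolding mixture_def using assms by (subst msum_index) (auto simp: o_def)
  also have "\<dots> = (\<Sum>v\<leftarrow>vs. v $ i * cnj (v $ j))"
    using assms by (intro arg_cong[where f = sum_list] map_cong refl ketbra_index) auto
  finally show ?thesis .
qed

lemma mixture_single: "v \<in> carrier_vec n \<Longrightarrow> mixture n [v] = ketbra v"
  by (auto simp: mixture_def msum_def)

lemma tr_mixture:
  assumes "set vs \<subseteq> carrier_vec n"
  shows "tr (mixture n vs) = of_real (\<Sum>v\<leftarrow>vs. sq_norm v)"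
proof -
  have "tr (mixture n vs) = (\<Sum>i<n. \<Sum>v\<leftarrow>vs. v $ i * cnj (v $ i))"
    unfolding tr_def using mixture_carrier[OF assms] assms
    by (intro sum.cong) (auto simp: mixture_index)
  also have "\<dots> = (\<Sum>v\<leftarrow>vs. \<Sum>i<n. v $ i * cnj (v $ i))"
    by (rule sum_sum_list_swap)
  also have "\<dots> = (\<Sum>v\<leftarrow>vs. of_real (sq_norm v))"
    using assms
    by (intro arg_cong[where f = sum_list] map_cong refl)
       (auto simp: sq_norm_def complex_norm_square subset_iff simp flip: of_real_power)
  also have "\<dots> = of_real (\<Sum>v\<leftarrow>vs. sq_norm v)"
    by (induction vs) simp_all
  finally show ?thesis .
qed

text \<open>Conjugating the projector of \<open>v\<close> by \<open>K\<close> gives the projector of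
  \<open>K v\<close>. A completely positive map therefore acts on an ensemble by applying each of
  its Kraus operators to each vector.\<close>

lemma apply_kraus_mixture:
  assumes Ks: "set Ks \<subseteq> carrier_mat n m" and vs: "set vs \<subseteq> carrier_vec m"
  shows "apply_kraus n Ks (mixture m vs) = mixture n (concat (map (\<lambda>K. map ((*\<^sub>v) K) vs) Ks))"
proof (rule eq_matI)
  have car: "set (concat (map (\<lambda>K. map ((*\<^sub>v) K) vs) Ks)) \<subseteq> carrier_vec n"
    using Ks vs by (auto intro!: mult_mat_vec_carrier)
  have car': "set (map (\<lambda>K. K * mixture m vs * mat_adjoint K) Ks) \<subseteq> carrier_mat n n"
    using Ks by (simp only: set_map image_subset_iff) (auto intro!: sandwich_carrier[of _ n m])
  show "dim_row (apply_kraus n Ks (mixture m vs)) =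
      dim_row (mixture n (concat (map (\<lambda>K. map ((*\<^sub>v) K) vs) Ks)))"
    "dim_col (apply_kraus n Ks (mixture m vs)) =
      dim_col (mixture n (concat (map (\<lambda>K. map ((*\<^sub>v) K) vs) Ks)))"
    using mixture_carrier[OF car] msum_carrier[OF car'] unfolding apply_kraus_def by auto
  fix i j
  assume "i < dim_row (mixture n (concat (map (\<lambda>K. map ((*\<^sub>v) K) vs) Ks)))"
    "j < dim_col (mixture n (concat (map (\<lambda>K. map ((*\<^sub>v) K) vs) Ks)))"
  then have ij: "i < n" "j < n" using mixture_carrier[OF car] by auto
  have "apply_kraus n Ks (mixture m vs) $$ (i, j) =
      (\<Sum>K\<leftarrow>Ks. (K * mixture m vs * mat_adjoint K) $$ (i, j))"
    unfolding apply_kraus_def by (subst msum_index[OF car' ij]) (simp add: o_def)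
  also have "\<dots> = (\<Sum>K\<leftarrow>Ks. \<Sum>v\<leftarrow>vs. (K *\<^sub>v v) $ i * cnj ((K *\<^sub>v v) $ j))"
  proof (intro arg_cong[where f = sum_list] map_cong refl)
    fix K assume "K \<in> set Ks"
    then have K: "K \<in> carrier_mat n m" using Ks by auto
    have "(K * mixture m vs * mat_adjoint K) $$ (i, j) =
        (\<Sum>l<m. (\<Sum>k<m. K $$ (i, k) * (\<Sum>v\<leftarrow>vs. v $ k * cnj (v $ l))) * cnj (K $$ (j, l)))"
      unfolding sandwich_index[OF K mixture_carrier[OF vs] ij]
      by (simp add: mixture_index[OF vs])
    also have "\<dots> = (\<Sum>v\<leftarrow>vs. \<Sum>l<m. (\<Sum>k<m. K $$ (i, k) * (v $ k * cnj (v $ l))) * cnj (K $$ (j, l)))"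
      by (simp only: sum_list_const_mult[symmetric] sum_list_mult_const[symmetric] sum_sum_list_swap)
    also have "\<dots> = (\<Sum>v\<leftarrow>vs. (K *\<^sub>v v) $ i * cnj ((K *\<^sub>v v) $ j))"
    proof (intro arg_cong[where f = sum_list] map_cong refl)
      fix v assume "v \<in> set vs"
      then have v: "v \<in> carrier_vec m" using vs by auto
      show "(\<Sum>l<m. (\<Sum>k<m. K $$ (i, k) * (v $ k * cnj (v $ l))) * cnj (K $$ (j, l))) =
          (K *\<^sub>v v) $ i * cnj ((K *\<^sub>v v) $ j)"
        unfolding mult_mat_vec_index[OF K v ij(1)] mult_mat_vec_index[OF K v ij(2)]
        by (simp add: sum_distrib_left sum_distrib_right mult_ac)
    qed
    finally show "(K * mixture m vs * mat_adjoint K) $$ (i, j) =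
      (\<Sum>v\<leftarrow>vs. (K *\<^sub>v v) $ i * cnj ((K *\<^sub>v v) $ j))" .
  qed
  also have "\<dots> = mixture n (concat (map (\<lambda>K. map ((*\<^sub>v) K) vs) Ks)) $$ (i, j)"
    by (simp add: mixture_index[OF car ij] sum_list_concat_map o_def)
  finally show "apply_kraus n Ks (mixture m vs) $$ (i, j) =
    mixture n (concat (map (\<lambda>K. map ((*\<^sub>v) K) vs) Ks)) $$ (i, j)" .
qed

lemma apply_Alice_mixture:
  assumes "set Ks \<subseteq> carrier_mat (2 * a') (2 * a)" "set vs \<subseteq> carrier_vec (2 * a * (2 * b))"
  shows "apply_Alice a' b Ks (mixture (2 * a * (2 * b)) vs) =
    mixture (2 * a' * (2 * b)) (concat (map (\<lambda>K. map ((*\<^sub>v) (kron K (1\<^sub>m (2 * b)))) vs) Ks))"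
proof -
  have "set (map (\<lambda>K. kron K (1\<^sub>m (2 * b))) Ks) \<subseteq> carrier_mat (2 * a' * (2 * b)) (2 * a * (2 * b))"
    using assms(1) kron_carrier[OF _ one_carrier_mat, of _ "2 * a'" "2 * a" "2 * b"]
    by (simp only: set_map image_subset_iff) blast
  from apply_kraus_mixture[OF this assms(2)] show ?thesis
    by (simp only: apply_Alice_def map_map o_def)
qed

lemma apply_Bob_mixture:
  assumes "set Ks \<subseteq> carrier_mat (2 * b') (2 * b)" "set vs \<subseteq> carrier_vec (2 * a * (2 * b))"
  shows "apply_Bob a b' Ks (mixture (2 * a * (2 * b)) vs) =
    mixture (2 * a * (2 * b')) (concat (map (\<lambda>K. map ((*\<^sub>v) (kron (1\<^sub>m (2 * a)) K)) vs) Ks))"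
proof -
  have "set (map (kron (1\<^sub>m (2 * a))) Ks) \<subseteq> carrier_mat (2 * a * (2 * b')) (2 * a * (2 * b))"
    using assms(1) kron_carrier[OF one_carrier_mat, of _ "2 * b'" "2 * b" "2 * a"]
    by (simp only: set_map image_subset_iff) blast
  from apply_kraus_mixture[OF this assms(2)] show ?thesis
    by (simp only: apply_Bob_def map_map o_def)
qed

section \<open>Conservation of the squared norm under a local instrument\<close>

lemma norm_square_sum_mult:
  fixes a x :: "nat \<Rightarrow> complex"
  shows "of_real ((cmod (\<Sum>j<c. a j * x j))\<^sup>2) =
    (\<Sum>j<c. \<Sum>l<c. cnj (a j) * a l * (cnj (x j) * x l))"
proof -
  have "of_real ((cmod (\<Sum>j<c. a j * x j))\<^sup>2) =
      (\<Sum>j<c. cnj (a j) * cnj (x j)) * (\<Sum>l<c. a l * x l)"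
    by (simp add: complex_norm_square mult.commute del: of_real_power)
  also have "\<dots> = (\<Sum>j<c. \<Sum>l<c. cnj (a j) * a l * (cnj (x j) * x l))"
    unfolding sum_product by (intro sum.cong refl) (simp add: mult_ac)
  finally show ?thesis .
qed

text \<open>The completeness relation, evaluated as a quadratic form at \<open>x\<close>. Here
  \<open>x\<close> is a function, so that it can be any slice of a bipartite vector, and
  \<open>dim_row K\<close> varies because outcomes may leave registers of different
  dimensions.\<close>

lemma complete_kraus_sum:
  fixes x :: "nat \<Rightarrow> complex"
  assumes E: "\<And>K. K \<in> set Ks \<Longrightarrow> dim_col K = c"
    and one: "msum c (map (\<lambda>K. mat_adjoint K * K) Ks) = 1\<^sub>m c"
  shows "(\<Sum>K\<leftarrow>Ks. \<Sum>i<dim_row K. (cmod (\<Sum>j<c. K $$ (i, j) * x j))\<^sup>2) = (\<Sum>j<c. (cmod (x j))\<^sup>2)"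
proof -
  have car: "set (map (\<lambda>K. mat_adjoint K * K) Ks) \<subseteq> carrier_mat c c"
    using E by auto
  have "of_real (\<Sum>K\<leftarrow>Ks. \<Sum>i<dim_row K. (cmod (\<Sum>j<c. K $$ (i, j) * x j))\<^sup>2) =
     (\<Sum>K\<leftarrow>Ks. of_real (\<Sum>i<dim_row K. (cmod (\<Sum>j<c. K $$ (i, j) * x j))\<^sup>2) :: complex)"
    by (induction Ks) simp_all
  also have "\<dots> = (\<Sum>K\<leftarrow>Ks. \<Sum>j<c. \<Sum>l<c. (mat_adjoint K * K) $$ (j, l) * (cnj (x j) * x l))"
  proof (intro arg_cong[where f = sum_list] map_cong refl)
    fix K assume "K \<in> set Ks"
    then have K: "K \<in> carrier_mat (dim_row K) c" using E by auto
    have "of_real (\<Sum>i<dim_row K. (cmod (\<Sum>j<c. K $$ (i, j) * x j))\<^sup>2) =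
        (\<Sum>i<dim_row K. \<Sum>j<c. \<Sum>l<c. cnj (K $$ (i, j)) * K $$ (i, l) * (cnj (x j) * x l))"
      by (simp only: of_real_sum norm_square_sum_mult)
    also have "\<dots> = (\<Sum>j<c. \<Sum>i<dim_row K. \<Sum>l<c. cnj (K $$ (i, j)) * K $$ (i, l) * (cnj (x j) * x l))"
      by (rule sum.swap)
    also have "\<dots> = (\<Sum>j<c. \<Sum>l<c. \<Sum>i<dim_row K. cnj (K $$ (i, j)) * K $$ (i, l) * (cnj (x j) * x l))"
      by (intro sum.cong refl sum.swap)
    also have "\<dots> = (\<Sum>j<c. \<Sum>l<c. (mat_adjoint K * K) $$ (j, l) * (cnj (x j) * x l))"
      by (intro sum.cong refl) (simp only: adjoint_mult_index[OF K] lessThan_iff sum_distrib_right)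
    finally show "of_real (\<Sum>i<dim_row K. (cmod (\<Sum>j<c. K $$ (i, j) * x j))\<^sup>2) =
      (\<Sum>j<c. \<Sum>l<c. (mat_adjoint K * K) $$ (j, l) * (cnj (x j) * x l))" .
  qed
  also have "\<dots> = (\<Sum>j<c. \<Sum>l<c. (\<Sum>K\<leftarrow>Ks. (mat_adjoint K * K) $$ (j, l)) * (cnj (x j) * x l))"
    by (simp only: sum_list_mult_const[symmetric] sum_sum_list_swap)
  also have "\<dots> = (\<Sum>j<c. \<Sum>l<c. if l = j then cnj (x j) * x l else 0)"
  proof (intro sum.cong refl)
    fix j l assume "j \<in> {..<c}" "l \<in> {..<c}"
    then have "(\<Sum>K\<leftarrow>Ks. (mat_adjoint K * K) $$ (j, l)) = 1\<^sub>m c $$ (j, l)"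
      using msum_index[OF car, of j l] unfolding one by (simp add: o_def)
    with \<open>j \<in> {..<c}\<close> \<open>l \<in> {..<c}\<close>
    show "(\<Sum>K\<leftarrow>Ks. (mat_adjoint K * K) $$ (j, l)) * (cnj (x j) * x l) =
       (if l = j then cnj (x j) * x l else 0)" by auto
  qed
  also have "\<dots> = of_real (\<Sum>j<c. (cmod (x j))\<^sup>2)"
    by (simp add: complex_norm_square mult.commute del: of_real_power)
  finally show ?thesis by (simp only: of_real_eq_iff)
qed

lemma sq_norm_product_index:
  "v \<in> carrier_vec (n * m) \<Longrightarrow> sq_norm v = (\<Sum>i<n. \<Sum>j<m. (cmod (v $ (i * m + j)))\<^sup>2)"
  by (auto simp: sq_norm_def sum_lessThan_mult_split)

text \<open>For each fixed index \<open>s\<close> of the other party, the entries of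
  \<open>v\<close> form a vector on which completeness holds; summing over \<open>s\<close> gives
  the claim.\<close>

lemma instrument_norm_left:
  assumes E: "\<And>K. K \<in> set Ks \<Longrightarrow> dim_col K = c"
    and one: "msum c (map (\<lambda>K. mat_adjoint K * K) Ks) = 1\<^sub>m c"
    and v: "v \<in> carrier_vec (c * m)"
  shows "(\<Sum>K\<leftarrow>Ks. sq_norm (kron K (1\<^sub>m m) *\<^sub>v v)) = sq_norm v"
proof -
  have "(\<Sum>K\<leftarrow>Ks. sq_norm (kron K (1\<^sub>m m) *\<^sub>v v)) =
      (\<Sum>K\<leftarrow>Ks. \<Sum>s<m. \<Sum>i<dim_row K. (cmod (\<Sum>j<c. K $$ (i, j) * v $ (j * m + s)))\<^sup>2)"
  proof (intro arg_cong[where f = sum_list] map_cong refl)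
    fix K assume "K \<in> set Ks"
    then have K: "K \<in> carrier_mat (dim_row K) c" using E by auto
    have "kron K (1\<^sub>m m) *\<^sub>v v \<in> carrier_vec (dim_row K * m)"
      by (rule mult_mat_vec_carrier[OF kron_carrier[OF K one_carrier_mat] v])
    then have "sq_norm (kron K (1\<^sub>m m) *\<^sub>v v) =
        (\<Sum>i<dim_row K. \<Sum>s<m. (cmod (\<Sum>j<c. K $$ (i, j) * v $ (j * m + s)))\<^sup>2)"
      using kron_one_right_mult_vec_index[OF K v] by (simp add: sq_norm_product_index)
    then show "sq_norm (kron K (1\<^sub>m m) *\<^sub>v v) =
        (\<Sum>s<m. \<Sum>i<dim_row K. (cmod (\<Sum>j<c. K $$ (i, j) * v $ (j * m + s)))\<^sup>2)"
      by (subst sum.swap)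
  qed
  also have "\<dots> = (\<Sum>s<m. \<Sum>j<c. (cmod (v $ (j * m + s)))\<^sup>2)"
    by (simp only: sum_sum_list_swap[symmetric] complete_kraus_sum[OF E one])
  also have "\<dots> = sq_norm v"
    by (subst sum.swap) (simp add: sq_norm_product_index[OF v])
  finally show ?thesis .
qed

lemma instrument_norm_right:
  assumes E: "\<And>K. K \<in> set Ks \<Longrightarrow> dim_col K = c"
    and one: "msum c (map (\<lambda>K. mat_adjoint K * K) Ks) = 1\<^sub>m c"
    and v: "v \<in> carrier_vec (m * c)"
  shows "(\<Sum>K\<leftarrow>Ks. sq_norm (kron (1\<^sub>m m) K *\<^sub>v v)) = sq_norm v"
proof -
  have "(\<Sum>K\<leftarrow>Ks. sq_norm (kron (1\<^sub>m m) K *\<^sub>v v)) =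
      (\<Sum>K\<leftarrow>Ks. \<Sum>s<m. \<Sum>i<dim_row K. (cmod (\<Sum>j<c. K $$ (i, j) * v $ (s * c + j)))\<^sup>2)"
  proof (intro arg_cong[where f = sum_list] map_cong refl)
    fix K assume "K \<in> set Ks"
    then have K: "K \<in> carrier_mat (dim_row K) c" using E by auto
    have "kron (1\<^sub>m m) K *\<^sub>v v \<in> carrier_vec (m * dim_row K)"
      by (rule mult_mat_vec_carrier[OF kron_carrier[OF one_carrier_mat K] v])
    then show "sq_norm (kron (1\<^sub>m m) K *\<^sub>v v) =
        (\<Sum>s<m. \<Sum>i<dim_row K. (cmod (\<Sum>j<c. K $$ (i, j) * v $ (s * c + j)))\<^sup>2)"
      using kron_one_left_mult_vec_index[OF K v] by (simp add: sq_norm_product_index)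
  qed
  also have "\<dots> = (\<Sum>s<m. \<Sum>j<c. (cmod (v $ (s * c + j)))\<^sup>2)"
    by (simp only: sum_sum_list_swap[symmetric] complete_kraus_sum[OF E one])
  also have "\<dots> = sq_norm v"
    by (simp add: sq_norm_product_index[OF v])
  finally show ?thesis .
qed

section \<open>Upper bound\<close>

text \<open>A Bell pair on \<open>AB\<close> tensor an arbitrary vector, written out entrywise.\<close>

definition bell_product :: "nat \<Rightarrow> nat \<Rightarrow> complex vec \<Rightarrow> bool" where
  "bell_product a b v \<longleftrightarrow> (\<forall>r<a. \<forall>s<b.
     v $ (r * (2 * b) + (b + s)) = 0 \<and> v $ ((a + r) * (2 * b) + s) = 0 \<and>
     v $ ((a + r) * (2 * b) + (b + s)) = v $ (r * (2 * b) + s))"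

text \<open>The four summands are the components with \<open>AB\<close> in 00, 01, 10 and 11;
  \<open>r\<close> and \<open>s\<close> run over the other registers of Alice and Bob.\<close>

lemma sq_norm_registers:
  assumes "v \<in> carrier_vec (2 * a * (2 * b))"
  shows "sq_norm v = (\<Sum>r<a. \<Sum>s<b.
    (cmod (v $ (r * (2 * b) + s)))\<^sup>2 + (cmod (v $ (r * (2 * b) + (b + s))))\<^sup>2 +
    (cmod (v $ ((a + r) * (2 * b) + s)))\<^sup>2 + (cmod (v $ ((a + r) * (2 * b) + (b + s))))\<^sup>2)"
proof -
  have two: "(\<Sum>i<2 * n. f i) = (\<Sum>r<n. f r + f (n + r))" for n and f :: "nat \<Rightarrow> real"
    using sum_lessThan_mult_split[of f 2 n] by (simp add: sum.distrib numeral_2_eq_2)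
  show ?thesis
    unfolding sq_norm_product_index[OF assms] two sum.distrib[symmetric] by (simp add: add.assoc)
qed

text \<open>All terms are nonnegative, so the nested sums can be peeled off one by one. This leads
  from a vanishing population of the reduced state to a vanishing amplitude in every member of the
  ensemble.\<close>

lemma sum_list_norm_square_zero:
  fixes f :: "'a \<Rightarrow> nat \<Rightarrow> nat \<Rightarrow> complex"
  assumes "(\<Sum>r<a. \<Sum>s<b. \<Sum>v\<leftarrow>vs. f v r s * cnj (f v r s)) = 0"
    and "v \<in> set vs" "r < a" "s < b"
  shows "f v r s = 0"
proof -
  have eq: "(\<Sum>v\<leftarrow>vs. f v r s * cnj (f v r s)) = of_real (\<Sum>v\<leftarrow>vs. (cmod (f v r s))\<^sup>2)" for r s
    by (induction vs) (simp_all add: complex_norm_square del: of_real_power)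
  have nonneg: "0 \<le> (\<Sum>v\<leftarrow>vs. (cmod (f v r s))\<^sup>2)" for r s
    by (intro sum_list_nonneg) auto
  have "(\<Sum>r<a. \<Sum>s<b. \<Sum>v\<leftarrow>vs. (cmod (f v r s))\<^sup>2) = 0"
    using assms(1) unfolding eq by (simp only: of_real_sum[symmetric] of_real_eq_0_iff)
  then have "\<forall>r<a. (\<Sum>s<b. \<Sum>v\<leftarrow>vs. (cmod (f v r s))\<^sup>2) = 0"
    by (subst (asm) sum_nonneg_eq_0_iff) (auto intro!: sum_nonneg nonneg)
  then have "(\<Sum>s<b. \<Sum>v\<leftarrow>vs. (cmod (f v r s))\<^sup>2) = 0"
    using \<open>r < a\<close> by blast
  then have "\<forall>s<b. (\<Sum>v\<leftarrow>vs. (cmod (f v r s))\<^sup>2) = 0"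
    by (subst (asm) sum_nonneg_eq_0_iff) (auto intro!: nonneg)
  then have "(\<Sum>v\<leftarrow>vs. (cmod (f v r s))\<^sup>2) = 0"
    using \<open>s < b\<close> by blast
  then have "\<forall>x \<in> set (map (\<lambda>v. (cmod (f v r s))\<^sup>2) vs). x = 0"
    by (subst (asm) sum_list_nonneg_eq_0_iff) auto
  then show ?thesis using \<open>v \<in> set vs\<close> by auto
qed

text \<open>A pure reduced state leaves no freedom to the ensemble: the reduced state has no
  population on 01, on 10, or on the direction |00> - |11>, so no member has a component
  there.\<close>

lemma bell_restored_mixtureD:
  assumes vs: "set vs \<subseteq> carrier_vec (2 * a * (2 * b))"
    and bell: "bell_restored a b (mixture (2 * a * (2 * b)) vs)"
    and v: "v \<in> set vs"
  shows "bell_product a b v"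
proof -
  define n where "n = 2 * a * (2 * b)"
  define \<rho> where "\<rho> = mixture n vs"
  define T where "T = inverse (tr \<rho>)"
  have T: "T \<noteq> 0" and red: "reduced_AB a b (T \<cdot>\<^sub>m \<rho>) = ketbra bell_ket"
    using bell by (auto simp: bell_restored_def T_def \<rho>_def n_def)
  \<comment> \<open>\<open>x i r s v\<close> is the amplitude of \<open>v\<close> with
    \<open>AB\<close> in basis state \<open>i\<close> and the other registers in \<open>r\<close>,
    \<open>s\<close>; \<open>G\<close> below is the reduced matrix on \<open>AB\<close> before
    division by the trace.\<close>
  define x where "x i r s v = v $ (((i div 2) * a + r) * (2 * b) + ((i mod 2) * b + s))"
    for i r s and v :: "complex vec"
  define G where "G i j = (\<Sum>r<a. \<Sum>s<b. \<Sum>v\<leftarrow>vs. x i r s v * cnj (x j r s v))" for i j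
  have idx: "((i div 2) * a + r) * (2 * b) + ((i mod 2) * b + s) < n"
    if "i < 4" "r < a" "s < b" for i r s
    unfolding n_def using that
    by (intro mult_add_less) (auto intro!: mult_add_less[of _ 2])
  have G: "T * G i j = ketbra bell_ket $$ (i, j)" if ij: "i < 4" "j < 4" for i j
  proof -
    have "reduced_AB a b (T \<cdot>\<^sub>m \<rho>) $$ (i, j) = (\<Sum>r<a. \<Sum>s<b. T * (\<Sum>v\<leftarrow>vs. x i r s v * cnj (x j r s v)))"
    proof -
      have "reduced_AB a b (T \<cdot>\<^sub>m \<rho>) $$ (i, j) = (\<Sum>r<a. \<Sum>s<b. (T \<cdot>\<^sub>m \<rho>) $$
         (((i div 2) * a + r) * (2 * b) + ((i mod 2) * b + s),
          ((j div 2) * a + r) * (2 * b) + ((j mod 2) * b + s)))"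
        using ij by (simp add: reduced_AB_def)
      also have "\<dots> = (\<Sum>r<a. \<Sum>s<b. T * (\<Sum>v\<leftarrow>vs. x i r s v * cnj (x j r s v)))"
      proof (intro sum.cong refl)
        fix r s assume rs: "r \<in> {..<a}" "s \<in> {..<b}"
        define k where "k = ((i div 2) * a + r) * (2 * b) + ((i mod 2) * b + s)"
        define l where "l = ((j div 2) * a + r) * (2 * b) + ((j mod 2) * b + s)"
        have kl: "k < n" "l < n" unfolding k_def l_def using idx ij rs by auto
        have vs': "set vs \<subseteq> carrier_vec n" using vs by (simp only: n_def)
        have "(T \<cdot>\<^sub>m \<rho>) $$ (k, l) = T * \<rho> $$ (k, l)"
          using kl mixture_carrier[OF vs'] unfolding \<rho>_def by (subst index_smult_mat) auto
        also have "\<rho> $$ (k, l) = (\<Sum>v\<leftarrow>vs. v $ k * cnj (v $ l))"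
          unfolding \<rho>_def by (rule mixture_index[OF vs' kl])
        finally show "(T \<cdot>\<^sub>m \<rho>) $$
         (((i div 2) * a + r) * (2 * b) + ((i mod 2) * b + s),
          ((j div 2) * a + r) * (2 * b) + ((j mod 2) * b + s)) =
          T * (\<Sum>v\<leftarrow>vs. x i r s v * cnj (x j r s v))"
          unfolding x_def k_def l_def .
      qed
      finally show ?thesis .
    qed
    then show ?thesis unfolding red G_def by (simp add: sum_distrib_left)
  qed
  have bk: "ketbra bell_ket $$ (i, j) = bell_ket $ i * cnj (bell_ket $ j)" if "i < 4" "j < 4" for i j
    using that by (simp add: ketbra_def bell_ket_def)
  have ent: "bell_ket $ 0 = of_real (1 / sqrt 2)" "bell_ket $ 1 = 0" "bell_ket $ 2 = 0"
    "bell_ket $ 3 = of_real (1 / sqrt 2)"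
    by (simp_all add: bell_ket_def numeral_2_eq_2 numeral_3_eq_3)
  have G': "T * G i j = bell_ket $ i * cnj (bell_ket $ j)" if "i < 4" "j < 4" for i j
    using G[OF that] bk[OF that] by simp
  have "T * G 1 1 = 0" "T * G 2 2 = 0"
    using G'[of 1 1] G'[of 2 2] unfolding ent by simp_all
  then have "G 1 1 = 0" "G 2 2 = 0"
    using T by simp_all
  \<comment> \<open>The four corner entries of the Bell projector are equal. Cancelling the nonzero
    factor \<open>T\<close> makes the population along |00> - |11> vanish.\<close>
  have "T * G 0 0 = T * G 0 3" "T * G 3 3 = T * G 0 3" "T * G 3 0 = T * G 0 3"
    using G'[of 0 0] G'[of 0 3] G'[of 3 0] G'[of 3 3] unfolding ent by simp_all
  then have "G 0 0 - G 0 3 - G 3 0 + G 3 3 = 0"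
    using T by simp
  then have diff: "(\<Sum>r<a. \<Sum>s<b. \<Sum>v\<leftarrow>vs. (x 0 r s v - x 3 r s v) * cnj (x 0 r s v - x 3 r s v)) = 0"
    unfolding G_def by (simp add: algebra_simps sum.distrib sum_subtractf sum_list_addf sum_list_subtractf)
  show ?thesis
    unfolding bell_product_def
  proof (intro allI impI)
    fix r s assume rs: "r < a" "s < b"
    have "x 1 r s v = 0"
      using \<open>G 1 1 = 0\<close> unfolding G_def
      by (rule sum_list_norm_square_zero[where f = "\<lambda>v r s. x 1 r s v", OF _ v rs])
    moreover have "x 2 r s v = 0"
      using \<open>G 2 2 = 0\<close> unfolding G_def
      by (rule sum_list_norm_square_zero[where f = "\<lambda>v r s. x 2 r s v", OF _ v rs])
    moreover have "x 0 r s v - x 3 r s v = 0"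
      using diff
      by (rule sum_list_norm_square_zero[where f = "\<lambda>v r s. x 0 r s v - x 3 r s v", OF _ v rs])
    ultimately show "v $ (r * (2 * b) + (b + s)) = 0 \<and> v $ ((a + r) * (2 * b) + s) = 0 \<and>
       v $ ((a + r) * (2 * b) + (b + s)) = v $ (r * (2 * b) + s)"
      by (simp add: x_def)
  qed
qed

section \<open>Product vectors are far from the Bell state\<close>

text \<open>The vector c(|00> + |11>), of squared norm 2|c|^2, has squared distance at least |c|^2
  from any product vector; being a product is the vanishing of a 2 x 2 determinant. The two diagonal
  terms equal |c|^2 plus a square minus a cross term, and the determinant condition lets the
  off-diagonal terms pay for the cross term.\<close>

lemma product_bell_distance:
  fixes c u00 u01 u10 u11 :: complex
  assumes "u00 * u11 = u01 * u10"
  shows "(cmod c)\<^sup>2 \<le> (cmod (c - u00))\<^sup>2 + (cmod u01)\<^sup>2 + (cmod u10)\<^sup>2 + (cmod (c - u11))\<^sup>2"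
proof -
  have "2 * Re (u00 * cnj u11) \<le> 2 * cmod (u00 * cnj u11)"
    using complex_Re_le_cmod[of "u00 * cnj u11"] by linarith
  also have "\<dots> = 2 * (cmod u01 * cmod u10)"
    using assms by (metis complex_mod_cnj norm_mult)
  also have "\<dots> \<le> (cmod u01)\<^sup>2 + (cmod u10)\<^sup>2"
    using sum_squares_bound[of "cmod u01" "cmod u10"] by simp
  finally have *: "2 * Re (u00 * cnj u11) \<le> (cmod u01)\<^sup>2 + (cmod u10)\<^sup>2" .
  have "(cmod (c - u00))\<^sup>2 + (cmod (c - u11))\<^sup>2 + 2 * Re (u00 * cnj u11) =
      (cmod c)\<^sup>2 + (cmod (c - (u00 + u11)))\<^sup>2"
    unfolding cmod_power2 by (simp add: power2_eq_square algebra_simps)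
  with * show ?thesis by (smt (verit) zero_le_power2)
qed

text \<open>The vector \<open>v\<close> is the remainder \<open>w\<close> plus a product vector
  across the cut between Alice and Bob. The factors are bare functions since only the product form
  is propagated, never their norms.\<close>

definition product_split :: "nat \<Rightarrow> nat \<Rightarrow> complex vec \<Rightarrow> complex vec \<Rightarrow> bool" where
  "product_split a b v w \<longleftrightarrow>
     v \<in> carrier_vec (2 * a * (2 * b)) \<and> w \<in> carrier_vec (2 * a * (2 * b)) \<and>
     (\<exists>f g. \<forall>i<2 * a. \<forall>j<2 * b. v $ (i * (2 * b) + j) = w $ (i * (2 * b) + j) + f i * g j)"

text \<open>A local operator sends the product of \<open>f\<close> and \<open>g\<close> to the
  product of \<open>K f\<close> and \<open>g\<close>.\<close>

lemma product_split_Alice: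
  assumes "product_split a b v w" and K: "K \<in> carrier_mat (2 * a') (2 * a)"
  shows "product_split a' b (kron K (1\<^sub>m (2 * b)) *\<^sub>v v) (kron K (1\<^sub>m (2 * b)) *\<^sub>v w)"
proof -
  obtain f g where v: "v \<in> carrier_vec (2 * a * (2 * b))" and w: "w \<in> carrier_vec (2 * a * (2 * b))"
    and fg: "\<And>i j. i < 2 * a \<Longrightarrow> j < 2 * b \<Longrightarrow> v $ (i * (2 * b) + j) = w $ (i * (2 * b) + j) + f i * g j"
    using assms(1) unfolding product_split_def by blast
  have eq: "(kron K (1\<^sub>m (2 * b)) *\<^sub>v v) $ (i * (2 * b) + j) =
      (kron K (1\<^sub>m (2 * b)) *\<^sub>v w) $ (i * (2 * b) + j) + (\<Sum>k<2 * a. K $$ (i, k) * f k) * g j"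
    if "i < 2 * a'" "j < 2 * b" for i j
    unfolding kron_one_right_mult_vec_index[OF K v that] kron_one_right_mult_vec_index[OF K w that]
    by (simp add: fg that distrib_left sum.distrib sum_distrib_right mult.assoc)
  have kc: "kron K (1\<^sub>m (2 * b)) \<in> carrier_mat (2 * a' * (2 * b)) (2 * a * (2 * b))"
    by (rule kron_carrier[OF K one_carrier_mat])
  show ?thesis
    unfolding product_split_def
    by (intro conjI exI[where x = "\<lambda>i. \<Sum>k<2 * a. K $$ (i, k) * f k"] exI[where x = "g"] allI impI
        mult_mat_vec_carrier[OF kc v] mult_mat_vec_carrier[OF kc w] eq)
qed

lemma product_split_Bob:
  assumes "product_split a b v w" and K: "K \<in> carrier_mat (2 * b') (2 * b)"
  shows "product_split a b' (kron (1\<^sub>m (2 * a)) K *\<^sub>v v) (kron (1\<^sub>m (2 * a)) K *\<^sub>v w)"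
proof -
  obtain f g where v: "v \<in> carrier_vec (2 * a * (2 * b))" and w: "w \<in> carrier_vec (2 * a * (2 * b))"
    and fg: "\<And>i j. i < 2 * a \<Longrightarrow> j < 2 * b \<Longrightarrow> v $ (i * (2 * b) + j) = w $ (i * (2 * b) + j) + f i * g j"
    using assms(1) unfolding product_split_def by blast
  have eq: "(kron (1\<^sub>m (2 * a)) K *\<^sub>v v) $ (i * (2 * b') + j) =
      (kron (1\<^sub>m (2 * a)) K *\<^sub>v w) $ (i * (2 * b') + j) + f i * (\<Sum>k<2 * b. K $$ (j, k) * g k)"
    if "i < 2 * a" "j < 2 * b'" for i j
    unfolding kron_one_left_mult_vec_index[OF K v that] kron_one_left_mult_vec_index[OF K w that]
    by (simp add: fg that distrib_left sum.distrib sum_distrib_left mult.left_commute)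
  have kc: "kron (1\<^sub>m (2 * a)) K \<in> carrier_mat (2 * a * (2 * b')) (2 * a * (2 * b))"
    by (rule kron_carrier[OF one_carrier_mat K])
  show ?thesis
    unfolding product_split_def
    by (intro conjI exI[where x = "f"] exI[where x = "\<lambda>j. \<Sum>k<2 * b. K $$ (j, k) * g k"] allI impI
        mult_mat_vec_carrier[OF kc v] mult_mat_vec_carrier[OF kc w] eq)
qed

text \<open>For fixed \<open>r\<close> and \<open>s\<close> the product vector restricts to a
  product vector on \<open>AB\<close>. The block of \<open>v\<close> has squared norm 2|c|^2, the
  block of \<open>w\<close> is its difference from that product, and the distance bound applies
  block by block.\<close>

lemma product_split_bell_bound:
  assumes "product_split a b v w" and bell: "bell_product a b v"
  shows "sq_norm v \<le> 2 * sq_norm w"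
proof -
  obtain f g where v: "v \<in> carrier_vec (2 * a * (2 * b))" and w: "w \<in> carrier_vec (2 * a * (2 * b))"
    and fg: "\<And>i j. i < 2 * a \<Longrightarrow> j < 2 * b \<Longrightarrow> v $ (i * (2 * b) + j) = w $ (i * (2 * b) + j) + f i * g j"
    using assms(1) unfolding product_split_def by blast
  show ?thesis
    unfolding sq_norm_registers[OF v] sq_norm_registers[OF w] sum_distrib_left
  proof (intro sum_mono)
    fix r s assume "r \<in> {..<a}" "s \<in> {..<b}"
    then have rs: "r < a" "s < b" by auto
    define c where "c = v $ (r * (2 * b) + s)"
    have bp: "v $ (r * (2 * b) + (b + s)) = 0" "v $ ((a + r) * (2 * b) + s) = 0"
      "v $ ((a + r) * (2 * b) + (b + s)) = c" "v $ (r * (2 * b) + s) = c"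
      using bell rs unfolding bell_product_def c_def by blast+
    have w_eq: "w $ (r * (2 * b) + s) = c - f r * g s"
      "w $ (r * (2 * b) + (b + s)) = - (f r * g (b + s))"
      "w $ ((a + r) * (2 * b) + s) = - (f (a + r) * g s)"
      "w $ ((a + r) * (2 * b) + (b + s)) = c - f (a + r) * g (b + s)"
    proof -
      have "c = w $ (r * (2 * b) + s) + f r * g s"
        "0 = w $ (r * (2 * b) + (b + s)) + f r * g (b + s)"
        "0 = w $ ((a + r) * (2 * b) + s) + f (a + r) * g s"
        "c = w $ ((a + r) * (2 * b) + (b + s)) + f (a + r) * g (b + s)"
        using fg[of r s] fg[of r "b + s"] fg[of "a + r" s] fg[of "a + r" "b + s"] rs
        unfolding bp by simp_all
      then show "w $ (r * (2 * b) + s) = c - f r * g s"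
        "w $ (r * (2 * b) + (b + s)) = - (f r * g (b + s))"
        "w $ ((a + r) * (2 * b) + s) = - (f (a + r) * g s)"
        "w $ ((a + r) * (2 * b) + (b + s)) = c - f (a + r) * g (b + s)"
        unfolding eq_diff_eq eq_neg_iff_add_eq_0 by metis+
    qed
    have "(cmod c)\<^sup>2 \<le> (cmod (c - f r * g s))\<^sup>2 + (cmod (f r * g (b + s)))\<^sup>2 +
        (cmod (f (a + r) * g s))\<^sup>2 + (cmod (c - f (a + r) * g (b + s)))\<^sup>2"
      by (rule product_bell_distance) (simp add: mult_ac)
    then show "(cmod (v $ (r * (2 * b) + s)))\<^sup>2 + (cmod (v $ (r * (2 * b) + (b + s))))\<^sup>2 +
      (cmod (v $ ((a + r) * (2 * b) + s)))\<^sup>2 + (cmod (v $ ((a + r) * (2 * b) + (b + s))))\<^sup>2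
      \<le> 2 * ((cmod (w $ (r * (2 * b) + s)))\<^sup>2 + (cmod (w $ (r * (2 * b) + (b + s))))\<^sup>2 +
      (cmod (w $ ((a + r) * (2 * b) + s)))\<^sup>2 + (cmod (w $ ((a + r) * (2 * b) + (b + s))))\<^sup>2)"
      unfolding bp w_eq by simp
  qed
qed

section \<open>Induction over the protocol tree\<close>

text \<open>\<open>ps\<close> lists pairs (full vector, remainder) for each unrecorded Kraus path; both evolve linearly.\<close>

lemma success_prob_le:
  fixes R :: "nat \<Rightarrow> nat \<Rightarrow> complex vec \<Rightarrow> complex vec \<Rightarrow> bool"
  assumes dim: "\<And>a b v w. R a b v w \<Longrightarrow>
      v \<in> carrier_vec (2 * a * (2 * b)) \<and> w \<in> carrier_vec (2 * a * (2 * b))"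
    and RA: "\<And>a a' b v w K. R a b v w \<Longrightarrow> K \<in> carrier_mat (2 * a') (2 * a) \<Longrightarrow>
      R a' b (kron K (1\<^sub>m (2 * b)) *\<^sub>v v) (kron K (1\<^sub>m (2 * b)) *\<^sub>v w)"
    and RB: "\<And>a b b' v w K. R a b v w \<Longrightarrow> K \<in> carrier_mat (2 * b') (2 * b) \<Longrightarrow>
      R a b' (kron (1\<^sub>m (2 * a)) K *\<^sub>v v) (kron (1\<^sub>m (2 * a)) K *\<^sub>v w)"
    and leaf: "\<And>a b v w. R a b v w \<Longrightarrow> bell_product a b v \<Longrightarrow> sq_norm v \<le> C * sq_norm w"
    and C: "0 \<le> C"
    and P: "locc_protocol P a b"
    and ps: "\<And>v w. (v, w) \<in> set ps \<Longrightarrow> R a b v w"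
  shows "success_prob P a b (mixture (2 * a * (2 * b)) (map fst ps)) \<le> C * (\<Sum>(v, w)\<leftarrow>ps. sq_norm w)"
  using P ps
proof (induction P arbitrary: a b ps)
  case Finish
  let ?\<rho> = "mixture (2 * a * (2 * b)) (map fst ps)"
  have vs: "set (map fst ps) \<subseteq> carrier_vec (2 * a * (2 * b))"
    using dim[OF Finish(2)] by auto
  show ?case
  proof (cases "bell_restored a b ?\<rho>")
    case True
    have "Re (tr ?\<rho>) = (\<Sum>(v, w)\<leftarrow>ps. sq_norm v)"
      using tr_mixture[OF vs] by (simp add: o_def case_prod_unfold)
    \<comment> \<open>A successful leaf is successful for each vector of its ensemble, so the leaf
      hypothesis can be summed over the ensemble.\<close>
    also have "\<dots> \<le> (\<Sum>(v, w)\<leftarrow>ps. C * sq_norm w)"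
    proof (rule sum_list_mono)
      fix p assume p: "p \<in> set ps"
      then have "R a b (fst p) (snd p)" using Finish(2)[of "fst p" "snd p"] by simp
      moreover have "bell_product a b (fst p)"
        using bell_restored_mixtureD[OF vs True] p by simp
      ultimately show "(case p of (v, w) \<Rightarrow> sq_norm v) \<le> (case p of (v, w) \<Rightarrow> C * sq_norm w)"
        using leaf by (simp add: case_prod_unfold)
    qed
    also have "\<dots> = C * (\<Sum>(v, w)\<leftarrow>ps. sq_norm w)"
      by (simp add: sum_list_const_mult case_prod_unfold)
    finally show ?thesis using True by simp
  next
    case False
    have "0 \<le> (\<Sum>(v, w)\<leftarrow>ps. sq_norm w)"
      by (intro sum_list_nonneg) (auto simp: sq_norm_def intro!: sum_nonneg)
    with False C show ?thesis by simp
  qed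
next
  case (Alice n d E D)
  have vs: "set (map fst ps) \<subseteq> carrier_vec (2 * a * (2 * b))"
    using dim[OF Alice.prems(2)] by auto
  have E: "set (E j) \<subseteq> carrier_mat (2 * d j) (2 * a)" if "j < n" for j
    using Alice.prems(1) that by (simp add: instrument_def)
  have one: "msum (2 * a) (map (\<lambda>K. mat_adjoint K * K) (concat (map E [0..<n]))) = 1\<^sub>m (2 * a)"
    using Alice.prems(1) by (simp add: instrument_def)
  define L where "L K = (*\<^sub>v) (kron K (1\<^sub>m (2 * b)))" for K
  \<comment> \<open>The ensemble after outcome \<open>j\<close>: every Kraus operator of that
    outcome applied to both components of every pair.\<close>
  define qs where "qs j = concat (map (\<lambda>K. map (\<lambda>(v, w). (L K v, L K w)) ps) (E j))" for j
  have "success_prob (Alice n d E D) a b (mixture (2 * a * (2 * b)) (map fst ps)) =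
    (\<Sum>j<n. success_prob (D j) (d j) b (mixture (2 * d j * (2 * b)) (map fst (qs j))))"
  proof -
    have "apply_Alice (d j) b (E j) (mixture (2 * a * (2 * b)) (map fst ps)) =
        mixture (2 * d j * (2 * b)) (map fst (qs j))" if "j < n" for j
      unfolding apply_Alice_mixture[OF E[OF that] vs]
      by (simp add: qs_def map_concat o_def L_def case_prod_unfold)
    then show ?thesis by simp
  qed
  also have "\<dots> \<le> (\<Sum>j<n. C * (\<Sum>(v, w)\<leftarrow>qs j. sq_norm w))"
  proof (rule sum_mono)
    fix j assume "j \<in> {..<n}"
    then have j: "j < n" by simp
    have "R (d j) b v w" if "(v, w) \<in> set (qs j)" for v w
    proof -
      have "(v, w) \<in> (\<Union>K\<in>set (E j). (\<lambda>(v, w). (L K v, L K w)) ` set ps)"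
        using that by (simp add: qs_def)
      then obtain K p where K: "K \<in> set (E j)" and p: "p \<in> set ps"
        and eq: "(v, w) = (case p of (v, w) \<Rightarrow> (L K v, L K w))"
        by blast
      have "(fst p, snd p) \<in> set ps" "K \<in> carrier_mat (2 * d j) (2 * a)"
        using p K E[OF j] by auto
      from RA[OF Alice.prems(2)[OF this(1)] this(2)] eq show ?thesis
        by (simp add: L_def case_prod_unfold)
    qed
    then show "success_prob (D j) (d j) b (mixture (2 * d j * (2 * b)) (map fst (qs j)))
        \<le> C * (\<Sum>(v, w)\<leftarrow>qs j. sq_norm w)"
      using Alice.IH[of "D j" "d j" b "qs j"] Alice.prems(1) j by simp
  qed
  \<comment> \<open>Joining the branches yields the Kraus operators of the whole instrument, which
    is the list in the completeness relation.\<close>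
  also have "\<dots> = C * (\<Sum>K\<leftarrow>concat (map E [0..<n]). \<Sum>(v, w)\<leftarrow>ps. sq_norm (L K w))"
    by (simp add: sum_distrib_left[symmetric] qs_def sum_list_concat_map o_def case_prod_unfold
        interv_sum_list_conv_sum_set_nat atLeast0LessThan)
  also have "\<dots> = C * (\<Sum>(v, w)\<leftarrow>ps. \<Sum>K\<leftarrow>concat (map E [0..<n]). sq_norm (L K w))"
  proof -
    have "(\<Sum>x\<leftarrow>xs. \<Sum>y\<leftarrow>ys. h x y) = (\<Sum>y\<leftarrow>ys. \<Sum>x\<leftarrow>xs. h x y)"
      for xs :: "complex mat list" and ys :: "(complex vec \<times> complex vec) list" and h :: "_ \<Rightarrow> _ \<Rightarrow> real"
      by (induction xs) (simp_all add: sum_list_addf)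
    then show ?thesis by (simp only: case_prod_unfold)
  qed
  \<comment> \<open>Completeness conserves the squared norm of each remainder over all outcomes, so
    the bound passes from the branches to the node.\<close>
  also have "(\<Sum>(v, w)\<leftarrow>ps. \<Sum>K\<leftarrow>concat (map E [0..<n]). sq_norm (L K w)) = (\<Sum>(v, w)\<leftarrow>ps. sq_norm w)"
  proof (intro arg_cong[where f = sum_list] map_cong refl)
    fix p assume p: "p \<in> set ps"
    have "(\<Sum>K\<leftarrow>concat (map E [0..<n]). sq_norm (L K (snd p))) = sq_norm (snd p)"
      unfolding L_def
    proof (rule instrument_norm_left[OF _ one])
      show "dim_col K = 2 * a" if "K \<in> set (concat (map E [0..<n]))" for K
        using that E by fastforce
      show "snd p \<in> carrier_vec (2 * a * (2 * b))"
        using dim[OF Alice.prems(2), of "fst p" "snd p"] p by simp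
    qed
    then show "(case p of (v, w) \<Rightarrow> \<Sum>K\<leftarrow>concat (map E [0..<n]). sq_norm (L K w)) =
      (case p of (v, w) \<Rightarrow> sq_norm w)"
      by (simp only: case_prod_unfold)
  qed
  finally show ?case .
next
  case (Bob n d E D)
  \<comment> \<open>Mirror image of Alice's case, with completeness applied to the right tensor
    factor.\<close>
  have vs: "set (map fst ps) \<subseteq> carrier_vec (2 * a * (2 * b))"
    using dim[OF Bob.prems(2)] by auto
  have E: "set (E j) \<subseteq> carrier_mat (2 * d j) (2 * b)" if "j < n" for j
    using Bob.prems(1) that by (simp add: instrument_def)
  have one: "msum (2 * b) (map (\<lambda>K. mat_adjoint K * K) (concat (map E [0..<n]))) = 1\<^sub>m (2 * b)"
    using Bob.prems(1) by (simp add: instrument_def)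
  define L where "L K = (*\<^sub>v) (kron (1\<^sub>m (2 * a)) K)" for K
  define qs where "qs j = concat (map (\<lambda>K. map (\<lambda>(v, w). (L K v, L K w)) ps) (E j))" for j
  have "success_prob (Bob n d E D) a b (mixture (2 * a * (2 * b)) (map fst ps)) =
    (\<Sum>j<n. success_prob (D j) a (d j) (mixture (2 * a * (2 * d j)) (map fst (qs j))))"
  proof -
    have "apply_Bob a (d j) (E j) (mixture (2 * a * (2 * b)) (map fst ps)) =
        mixture (2 * a * (2 * d j)) (map fst (qs j))" if "j < n" for j
      unfolding apply_Bob_mixture[OF E[OF that] vs]
      by (simp add: qs_def map_concat o_def L_def case_prod_unfold)
    then show ?thesis by simp
  qed
  also have "\<dots> \<le> (\<Sum>j<n. C * (\<Sum>(v, w)\<leftarrow>qs j. sq_norm w))"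
  proof (rule sum_mono)
    fix j assume "j \<in> {..<n}"
    then have j: "j < n" by simp
    have "R a (d j) v w" if "(v, w) \<in> set (qs j)" for v w
    proof -
      have "(v, w) \<in> (\<Union>K\<in>set (E j). (\<lambda>(v, w). (L K v, L K w)) ` set ps)"
        using that by (simp add: qs_def)
      then obtain K p where K: "K \<in> set (E j)" and p: "p \<in> set ps"
        and eq: "(v, w) = (case p of (v, w) \<Rightarrow> (L K v, L K w))"
        by blast
      have "(fst p, snd p) \<in> set ps" "K \<in> carrier_mat (2 * d j) (2 * b)"
        using p K E[OF j] by auto
      from RB[OF Bob.prems(2)[OF this(1)] this(2)] eq show ?thesis
        by (simp add: L_def case_prod_unfold)
    qed
    then show "success_prob (D j) a (d j) (mixture (2 * a * (2 * d j)) (map fst (qs j)))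
        \<le> C * (\<Sum>(v, w)\<leftarrow>qs j. sq_norm w)"
      using Bob.IH[of "D j" a "d j" "qs j"] Bob.prems(1) j by simp
  qed
  also have "\<dots> = C * (\<Sum>K\<leftarrow>concat (map E [0..<n]). \<Sum>(v, w)\<leftarrow>ps. sq_norm (L K w))"
    by (simp add: sum_distrib_left[symmetric] qs_def sum_list_concat_map o_def case_prod_unfold
        interv_sum_list_conv_sum_set_nat atLeast0LessThan)
  also have "\<dots> = C * (\<Sum>(v, w)\<leftarrow>ps. \<Sum>K\<leftarrow>concat (map E [0..<n]). sq_norm (L K w))"
  proof -
    have "(\<Sum>x\<leftarrow>xs. \<Sum>y\<leftarrow>ys. h x y) = (\<Sum>y\<leftarrow>ys. \<Sum>x\<leftarrow>xs. h x y)"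
      for xs :: "complex mat list" and ys :: "(complex vec \<times> complex vec) list" and h :: "_ \<Rightarrow> _ \<Rightarrow> real"
      by (induction xs) (simp_all add: sum_list_addf)
    then show ?thesis by (simp only: case_prod_unfold)
  qed
  also have "(\<Sum>(v, w)\<leftarrow>ps. \<Sum>K\<leftarrow>concat (map E [0..<n]). sq_norm (L K w)) = (\<Sum>(v, w)\<leftarrow>ps. sq_norm w)"
  proof (intro arg_cong[where f = sum_list] map_cong refl)
    fix p assume p: "p \<in> set ps"
    have "(\<Sum>K\<leftarrow>concat (map E [0..<n]). sq_norm (L K (snd p))) = sq_norm (snd p)"
      unfolding L_def
    proof (rule instrument_norm_right[OF _ one])
      show "dim_col K = 2 * b" if "K \<in> set (concat (map E [0..<n]))" for K
        using that E by fastforce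
      show "snd p \<in> carrier_vec (2 * a * (2 * b))"
        using dim[OF Bob.prems(2), of "fst p" "snd p"] p by simp
    qed
    then show "(case p of (v, w) \<Rightarrow> \<Sum>K\<leftarrow>concat (map E [0..<n]). sq_norm (L K w)) =
      (case p of (v, w) \<Rightarrow> sq_norm w)"
      by (simp only: case_prod_unfold)
  qed
  finally show ?case .
qed

text \<open>Taking the remainder equal to the full vector, with constant 1, turns the induction into
  the bound by total probability.\<close>

lemma success_prob_le_sq_norm:
  assumes P: "locc_protocol P a b" and v: "v \<in> carrier_vec (2 * a * (2 * b))"
  shows "success_prob P a b (ketbra v) \<le> sq_norm v"
proof -
  let ?R = "\<lambda>a b v w. v \<in> carrier_vec (2 * a * (2 * b)) \<and> v = w"
  have "success_prob P a b (mixture (2 * a * (2 * b)) (map fst [(v, v)])) \<le>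
      1 * (\<Sum>(v, w)\<leftarrow>[(v, v)]. sq_norm w)"
  proof (rule success_prob_le[where R = ?R, OF _ _ _ _ _ P])
    show "?R a' b (kron K (1\<^sub>m (2 * b)) *\<^sub>v v) (kron K (1\<^sub>m (2 * b)) *\<^sub>v w)"
      if "?R a b v w" "K \<in> carrier_mat (2 * a') (2 * a)" for a a' b v w K
      using that mult_mat_vec_carrier[OF kron_carrier[OF that(2) one_carrier_mat]] by blast
    show "?R a b' (kron (1\<^sub>m (2 * a)) K *\<^sub>v v) (kron (1\<^sub>m (2 * a)) K *\<^sub>v w)"
      if "?R a b v w" "K \<in> carrier_mat (2 * b') (2 * b)" for a b b' v w K
      using that mult_mat_vec_carrier[OF kron_carrier[OF one_carrier_mat that(2)]] by blast
  qed (use v in auto)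
  then show ?thesis unfolding list.map fst_conv mixture_single[OF v] by simp
qed

text \<open>The same induction with constant 2: twice the squared norm of the remainder pays for all
  success.\<close>

lemma success_prob_le_product_split:
  assumes P: "locc_protocol P a b" and split: "product_split a b v w"
  shows "success_prob P a b (ketbra v) \<le> 2 * sq_norm w"
proof -
  have v: "v \<in> carrier_vec (2 * a * (2 * b))" using split by (simp add: product_split_def)
  have "success_prob P a b (mixture (2 * a * (2 * b)) (map fst [(v, w)])) \<le>
      2 * (\<Sum>(v, w)\<leftarrow>[(v, w)]. sq_norm w)"
    by (rule success_prob_le[where R = product_split, OF _ product_split_Alice product_split_Bob
          product_split_bell_bound _ P])
       (use split in \<open>auto simp: product_split_def\<close>)
  then show ?thesis unfolding list.map fst_conv mixture_single[OF v] by simp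
qed

section \<open>Attainment\<close>

text \<open>The vector \<open>\<Sum>k<4. t k |e k\<rangle>|k\<rangle>\<close>; only the squares of the real numbers \<open>t k\<close> are Schmidt weights.\<close>

definition schmidt_vec :: "nat \<Rightarrow> (nat \<Rightarrow> nat) \<Rightarrow> (nat \<Rightarrow> real) \<Rightarrow> complex vec" where
  "schmidt_vec a e t = vec (2 * a * (2 * 2))
     (\<lambda>n. if n div 4 = e (n mod 4) then of_real (t (n mod 4)) else 0)"

lemma schmidt_vec_carrier: "schmidt_vec a e t \<in> carrier_vec (2 * a * (2 * 2))"
  by (simp add: schmidt_vec_def)

lemma schmidt_vec_index:
  assumes "i < 2 * a" "k < 2 * 2"
  shows "schmidt_vec a e t $ (i * (2 * 2) + k) = (if i = e k then of_real (t k) else 0)"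
  using mult_add_less[OF assms] assms by (simp add: schmidt_vec_def)

lemma sq_norm_schmidt_vec:
  assumes "\<And>k. k < 4 \<Longrightarrow> e k < 2 * a"
  shows "sq_norm (schmidt_vec a e t) = (\<Sum>k<4. (t k)\<^sup>2)"
proof -
  have "sq_norm (schmidt_vec a e t) = (\<Sum>i<2 * a. \<Sum>k<2 * 2. if i = e k then (t k)\<^sup>2 else 0)"
    unfolding sq_norm_product_index[OF schmidt_vec_carrier]
  proof (intro sum.cong refl)
    fix i k :: nat assume "i \<in> {..<2 * a}" "k \<in> {..<2 * 2}"
    then have ik: "i < 2 * a" "k < 2 * 2" by simp_all
    show "(cmod (schmidt_vec a e t $ (i * (2 * 2) + k)))\<^sup>2 = (if i = e k then (t k)\<^sup>2 else 0)"
      unfolding schmidt_vec_index[OF ik] by simp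
  qed
  also have "\<dots> = (\<Sum>k<2 * 2. \<Sum>i<2 * a. if i = e k then (t k)\<^sup>2 else 0)"
    by (rule sum.swap)
  also have "\<dots> = (\<Sum>k<4. (t k)\<^sup>2)"
    using assms by simp
  finally show ?thesis .
qed

text \<open>Erasing the coefficient of index 0 removes the single term |e 0>|0>, which is a product
  vector.\<close>

lemma product_split_schmidt_vec:
  assumes "\<And>k. 0 < k \<Longrightarrow> k < 4 \<Longrightarrow> u k = t k" "u 0 = 0"
  shows "product_split a 2 (schmidt_vec a e t) (schmidt_vec a e u)"
  unfolding product_split_def
proof (intro conjI schmidt_vec_carrier,
    rule exI[where x = "\<lambda>i. if i = e 0 then of_real (t 0) else 0"],
    rule exI[where x = "\<lambda>j. if j = 0 then 1 else 0"], intro allI impI)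
  fix i j :: nat assume ij: "i < 2 * a" "j < 2 * 2"
  show "schmidt_vec a e t $ (i * (2 * 2) + j) = schmidt_vec a e u $ (i * (2 * 2) + j) +
      (if i = e 0 then of_real (t 0) else 0) * (if j = 0 then 1 else 0)"
    unfolding schmidt_vec_index[OF ij] using assms ij by (cases "j = 0") auto
qed

lemma sum_lessThan_2: "(\<Sum>x<2. f x) = f 0 + f (Suc 0)" for f :: "nat \<Rightarrow> 'a::comm_monoid_add"
  by (simp add: numeral_2_eq_2)

lemma sum_lessThan_4: "(\<Sum>x<4. f x) = f 0 + f 1 + f 2 + f 3" for f :: "nat \<Rightarrow> 'a::comm_monoid_add"
  by (simp add: eval_nat_numeral)

section \<open>The pairing protocol\<close>

text \<open>Bob's map that relabels the basis states \<open>s 0\<close> and \<open>s 1\<close> as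
  the values 0 and 1 of his qubit and annihilates the other basis states. The dimensions are written
  \<open>2 * 1\<close> and \<open>2 * 2\<close> to fit the shape in \<open>instrument\<close>; his
  remaining register is trivial.\<close>

definition select_pair :: "(nat \<Rightarrow> nat) \<Rightarrow> complex mat" where
  "select_pair s = mat (2 * 1) (2 * 2) (\<lambda>(x, k). if k = s x then 1 else 0)"

lemma select_pair_carrier: "select_pair s \<in> carrier_mat (2 * 1) (2 * 2)"
  by (simp add: select_pair_def)

text \<open>Each adjoint product projects onto the basis states of one pair, and the two pairs
  partition the four indices. Both Kraus operators belong to one single outcome, so Bob announces
  nothing.\<close>

lemma instrument_select_pair:
  assumes "distinct [s 0, s 1, u 0, u 1]" "\<And>k. k < 4 \<Longrightarrow> k \<in> {s 0, s 1, u 0, u 1}"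
  shows "instrument 2 1 (\<lambda>_. 1) (\<lambda>_. [select_pair s, select_pair u])"
proof -
  let ?Ms = "map (\<lambda>K. mat_adjoint K * K) [select_pair s, select_pair u]"
  have car: "set ?Ms \<subseteq> carrier_mat (2 * 2) (2 * 2)"
    using select_pair_carrier by (auto simp: select_pair_def)
  have "msum (2 * 2) ?Ms = 1\<^sub>m (2 * 2)"
  proof (rule eq_matI)
    fix k l assume "k < dim_row (1\<^sub>m (2 * 2) :: complex mat)" "l < dim_col (1\<^sub>m (2 * 2) :: complex mat)"
    then have kl: "k < 2 * 2" "l < 2 * 2" by simp_all
    have ent: "(mat_adjoint (select_pair s) * select_pair s) $$ (k, l) =
       (if k = l \<and> k \<in> {s 0, s 1} then 1 else 0)" if "s 0 \<noteq> s 1" for s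
      unfolding adjoint_mult_index[OF select_pair_carrier kl]
      using kl that by (auto simp: select_pair_def sum_lessThan_2)
    have "k \<in> {s 0, s 1} \<longleftrightarrow> k \<notin> {u 0, u 1}"
      using assms(1) assms(2)[of k] kl by auto
    then show "msum (2 * 2) ?Ms $$ (k, l) = 1\<^sub>m (2 * 2) $$ (k, l)"
      unfolding msum_index[OF car kl] using assms(1) kl by (simp add: ent)
  qed (use msum_carrier[OF car] in auto)
  then show ?thesis
    unfolding instrument_def using select_pair_carrier by auto
qed

lemma success_prob_Finish_nonneg:
  assumes "set vs \<subseteq> carrier_vec n"
  shows "0 \<le> success_prob Finish a b (mixture n vs)"
proof -
  have "0 \<le> (\<Sum>v\<leftarrow>vs. sq_norm v)"
    by (intro sum_list_nonneg) (auto simp: sq_norm_def intro!: sum_nonneg)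
  then show ?thesis by (simp add: tr_mixture[OF assms])
qed

text \<open>With trivial remaining registers the state on \<open>AB\<close> is the whole state. The
  zero vector \<open>u\<close> stands for the contribution of Bob's second Kraus operator.\<close>

lemma success_prob_Finish_bell:
  assumes v: "v \<in> carrier_vec 4" "\<And>k. k < 4 \<Longrightarrow> v $ k = (if k = 0 \<or> k = 3 then of_real c else 0)"
    and u: "u \<in> carrier_vec 4" "\<And>k. k < 4 \<Longrightarrow> u $ k = 0"
  shows "success_prob Finish 1 1 (mixture 4 [v, u]) = 2 * c\<^sup>2"
proof -
  define \<rho> where "\<rho> = mixture 4 [v, u]"
  have vs: "set [v, u] \<subseteq> carrier_vec 4" using v u by simp
  have "sq_norm v = 2 * c\<^sup>2" "sq_norm u = 0"
    using v u by (simp_all add: sq_norm_def sum_lessThan_4)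
  then have tr: "tr \<rho> = of_real (2 * c\<^sup>2)"
    unfolding \<rho>_def tr_mixture[OF vs] by simp
  have "bell_restored 1 1 \<rho>" if c: "c \<noteq> 0"
  proof -
    have "reduced_AB 1 1 (inverse (tr \<rho>) \<cdot>\<^sub>m \<rho>) = ketbra bell_ket"
    proof (rule eq_matI)
      fix i j assume "i < dim_row (ketbra bell_ket)" "j < dim_col (ketbra bell_ket)"
      then have ij: "i < 4" "j < 4" by (simp_all add: ketbra_def bell_ket_def)
      have "reduced_AB 1 1 (inverse (tr \<rho>) \<cdot>\<^sub>m \<rho>) $$ (i, j) = (inverse (tr \<rho>) \<cdot>\<^sub>m \<rho>) $$ (i, j)"
        using ij by (simp add: reduced_AB_def)
      also have "\<dots> = inverse (tr \<rho>) * \<rho> $$ (i, j)"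
        using ij mixture_carrier[OF vs] unfolding \<rho>_def by (subst index_smult_mat) auto
      also have "\<rho> $$ (i, j) = v $ i * cnj (v $ j)"
        unfolding \<rho>_def mixture_index[OF vs ij] using u ij by simp
      also have "inverse (tr \<rho>) * (v $ i * cnj (v $ j)) =
          of_real (if (i = 0 \<or> i = 3) \<and> (j = 0 \<or> j = 3) then 1 / 2 else 0)"
        unfolding tr v(2)[OF ij(1)] v(2)[OF ij(2)] using c by (simp add: power2_eq_square field_simps)
      also have "\<dots> = ketbra bell_ket $$ (i, j)"
      proof -
        have ent: "bell_ket $ k = of_real (if k = 0 \<or> k = 3 then 1 / sqrt 2 else 0)" if "k < 4" for k
        proof -
          have "k = 0 \<or> k = 1 \<or> k = 2 \<or> k = 3" using that by auto
          then show ?thesis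
            by (elim disjE) (simp_all add: bell_ket_def numeral_2_eq_2 numeral_3_eq_3)
        qed
        have "ketbra bell_ket $$ (i, j) = bell_ket $ i * cnj (bell_ket $ j)"
          using ij by (simp add: ketbra_def bell_ket_def)
        then show ?thesis
          unfolding ent[OF ij(1)] ent[OF ij(2)] by (simp flip: of_real_mult)
      qed
      finally show "reduced_AB 1 1 (inverse (tr \<rho>) \<cdot>\<^sub>m \<rho>) $$ (i, j) = ketbra bell_ket $$ (i, j)" .
    qed (simp_all add: reduced_AB_def ketbra_def bell_ket_def)
    then show ?thesis using c tr by (simp add: bell_restored_def)
  qed
  then show ?thesis
    \<comment> \<open>For \<open>c = 0\<close> the trace is 0 and the Bell test fails, but both
      sides are then 0.\<close>
    unfolding \<rho>_def[symmetric] by (cases "c = 0") (simp_all add: tr)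
qed

text \<open>\<open>u\<close> enumerates the complement of the pair \<open>s\<close> only to make Bob's map trace preserving.\<close>

lemma schmidt_pair_branch:
  fixes t :: "nat \<Rightarrow> real"
  assumes e: "\<And>k. k < 4 \<Longrightarrow> e k < 2 * a" "inj_on e {..<4}"
    and t: "\<And>k. k < 4 \<Longrightarrow> t k \<noteq> 0" and c: "0 \<le> c"
    and s: "\<And>x. x < 2 \<Longrightarrow> s x < 4" "\<And>x. x < 2 \<Longrightarrow> u x < 4" "distinct [s 0, s 1, u 0, u 1]"
    and M: "M = mat (2 * 1) (2 * a) (\<lambda>(x, i). if i = e (s x) then of_real (sqrt c / t (s x)) else 0)"
  shows "success_prob (Bob 1 (\<lambda>_. 1) (\<lambda>_. [select_pair s, select_pair u]) (\<lambda>_. Finish)) 1 2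
      (apply_Alice 1 2 [M] (ketbra (schmidt_vec a e t))) = 2 * c"
proof -
  have Mc: "M \<in> carrier_mat (2 * 1) (2 * a)" by (simp add: M)
  define \<phi> where "\<phi> = kron M (1\<^sub>m (2 * 2)) *\<^sub>v schmidt_vec a e t"
  have \<phi>c: "\<phi> \<in> carrier_vec (2 * 1 * (2 * 2))"
    unfolding \<phi>_def by (rule mult_mat_vec_carrier[OF kron_carrier[OF Mc one_carrier_mat] schmidt_vec_carrier])
  \<comment> \<open>Alice's factor \<open>sqrt c / t (s x)\<close> cancels the Schmidt coefficient
    together with its sign, which leaves equal amplitudes on the two indices of the pair.\<close>
  have \<phi>: "\<phi> $ (x * (2 * 2) + k) = (if k = s x then of_real (sqrt c) else 0)"
    if xk: "x < 2 * 1" "k < 2 * 2" for x k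
  proof -
    have inj: "e (s x) = e k \<longleftrightarrow> s x = k"
      using inj_on_eq_iff[OF e(2), of "s x" k] s(1)[of x] xk by simp
    have "\<phi> $ (x * (2 * 2) + k) =
        (\<Sum>i<2 * a. if i = e (s x) then of_real (sqrt c / t (s x)) * (if i = e k then of_real (t k) else 0) else 0)"
      unfolding \<phi>_def kron_one_right_mult_vec_index[OF Mc schmidt_vec_carrier xk]
    proof (intro sum.cong refl)
      fix i assume "i \<in> {..<2 * a}"
      then have i: "i < 2 * a" by simp
      then have "M $$ (x, i) = (if i = e (s x) then of_real (sqrt c / t (s x)) else 0)"
        using xk by (simp add: M)
      then show "M $$ (x, i) * schmidt_vec a e t $ (i * (2 * 2) + k) =
        (if i = e (s x) then of_real (sqrt c / t (s x)) * (if i = e k then of_real (t k) else 0) else 0)"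
        unfolding schmidt_vec_index[OF i xk(2)] by simp
    qed
    also have "\<dots> = of_real (sqrt c / t (s x)) * (if e (s x) = e k then of_real (t k) else 0)"
      using e(1)[OF s(1)[of x]] xk by simp
    also have "\<dots> = (if k = s x then of_real (sqrt c) else 0)"
      unfolding inj using t[of k] xk by auto
    finally show ?thesis .
  qed
  define \<chi> where "\<chi> s' = kron (1\<^sub>m (2 * 1)) (select_pair s') *\<^sub>v \<phi>" for s'
  have \<chi>c: "\<chi> s' \<in> carrier_vec (2 * 1 * (2 * 1))" for s'
    unfolding \<chi>_def by (rule mult_mat_vec_carrier[OF kron_carrier[OF one_carrier_mat select_pair_carrier] \<phi>c])
  \<comment> \<open>For \<open>s' = s\<close> the two qubits agree exactly when the amplitude is
    kept; for the complementary pair \<open>u\<close> no index matches and the vector is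
    zero.\<close>
  have \<chi>: "\<chi> s' $ (x * (2 * 1) + y) = (if s' y = s x then of_real (sqrt c) else 0)"
    if xy: "x < 2 * 1" "y < 2 * 1" and s': "\<And>y. y < 2 \<Longrightarrow> s' y < 4" for s' x y
  proof -
    have "\<chi> s' $ (x * (2 * 1) + y) = (\<Sum>k<2 * 2. if k = s' y then (if k = s x then of_real (sqrt c) else 0) else 0)"
      unfolding \<chi>_def kron_one_left_mult_vec_index[OF select_pair_carrier \<phi>c xy]
    proof (intro sum.cong refl)
      fix k :: nat assume "k \<in> {..<2 * 2}"
      then have k: "k < 2 * 2" by simp
      show "select_pair s' $$ (y, k) * \<phi> $ (x * (2 * 2) + k) =
        (if k = s' y then (if k = s x then of_real (sqrt c) else 0) else 0)"
        unfolding \<phi>[OF xy(1) k] using k xy by (simp add: select_pair_def)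
    qed
    then show ?thesis using s'[of y] xy by simp
  qed
  have four: "k = 0 * (2 * 1) + 0 \<or> k = 0 * (2 * 1) + 1 \<or> k = 1 * (2 * 1) + 0 \<or> k = 1 * (2 * 1) + 1"
    if "k < 4" for k :: nat
    using that by auto
  have \<chi>s: "\<chi> s $ k = (if k = 0 \<or> k = 3 then of_real (sqrt c) else 0)" if "k < 4" for k
    using four[OF that] \<chi>[of 0 0 s] \<chi>[of 0 1 s] \<chi>[of 1 0 s] \<chi>[of 1 1 s] s by auto
  have \<chi>u: "\<chi> u $ k = 0" if "k < 4" for k
    using four[OF that] \<chi>[of 0 0 u] \<chi>[of 0 1 u] \<chi>[of 1 0 u] \<chi>[of 1 1 u] s by auto
  have "apply_Alice 1 2 [M] (ketbra (schmidt_vec a e t)) = mixture (2 * 1 * (2 * 2)) [\<phi>]"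
    using apply_Alice_mixture[of "[M]" 1 a "[schmidt_vec a e t]" 2] Mc schmidt_vec_carrier
    by (simp add: \<phi>_def mixture_single[OF schmidt_vec_carrier, simplified])
  moreover have "apply_Bob 1 1 [select_pair s, select_pair u] (mixture (2 * 1 * (2 * 2)) [\<phi>]) =
      mixture (2 * 1 * (2 * 1)) [\<chi> s, \<chi> u]"
    using apply_Bob_mixture[of "[select_pair s, select_pair u]" 1 2 "[\<phi>]" 1] select_pair_carrier \<phi>c
    by (simp add: \<chi>_def)
  moreover have "success_prob Finish 1 1 (mixture 4 [\<chi> s, \<chi> u]) = 2 * (sqrt c)\<^sup>2"
    using \<chi>c by (intro success_prob_Finish_bell \<chi>s \<chi>u) simp_all
  ultimately show ?thesis using c by (simp del: success_prob.simps(1))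
qed

text \<open>\<open>W j\<close> is the weight of the \<open>j\<close>-th of the pairs \<open>{0,3}, {0,1}, {0,2}, {1,2}\<close>.\<close>

lemma schmidt_protocol:
  fixes t W :: "nat \<Rightarrow> real"
  assumes e: "\<And>k. k < 4 \<Longrightarrow> e k < 2 * a" "inj_on e {..<4}"
    and t: "\<And>k. k < 4 \<Longrightarrow> t k \<noteq> 0"
    and W: "\<And>j. j < 4 \<Longrightarrow> 0 \<le> W j"
    and deg: "W 0 + W 1 + W 2 \<le> (t 0)\<^sup>2" "W 1 + W 3 \<le> (t 1)\<^sup>2" "W 2 + W 3 \<le> (t 2)\<^sup>2" "W 0 \<le> (t 3)\<^sup>2"
  shows "\<exists>P. locc_protocol P a 2 \<and>
    2 * (W 0 + W 1 + W 2 + W 3) \<le> success_prob P a 2 (ketbra (schmidt_vec a e t))"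
proof -
  have a: "0 < a" using e(1)[of 0] by simp
  \<comment> \<open>\<open>S j\<close> enumerates the \<open>j\<close>-th pair and
    \<open>U j\<close> its complement in {0,1,2,3}.\<close>
  define S :: "nat \<Rightarrow> nat \<Rightarrow> nat" where "S j x = [[0, 3], [0, 1], [0, 2], [1, 2]] ! j ! x" for j x
  define U :: "nat \<Rightarrow> nat \<Rightarrow> nat" where "U j x = [[1, 2], [2, 3], [1, 3], [0, 3]] ! j ! x" for j x
  have four: "k = 0 \<or> k = 1 \<or> k = 2 \<or> k = 3" if "k < 4" for k :: nat
    using that by auto
  have S_val: "S 0 0 = 0" "S 0 1 = 3" "S 1 0 = 0" "S 1 1 = 1" "S 2 0 = 0" "S 2 1 = 2" "S 3 0 = 1" "S 3 1 = 2"
    by (simp_all add: S_def)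
  have U_val: "U 0 0 = 1" "U 0 1 = 2" "U 1 0 = 2" "U 1 1 = 3" "U 2 0 = 1" "U 2 1 = 3" "U 3 0 = 0" "U 3 1 = 3"
    by (simp_all add: U_def)
  have dist: "distinct [S j 0, S j 1, U j 0, U j 1]" if "j < 4" for j
    using four[OF that] by (elim disjE) (simp_all only: S_val U_val, simp_all)
  have cover: "k \<in> {S j 0, S j 1, U j 0, U j 1}" if "j < 4" "k < 4" for j k
    using four[OF that(1)] four[OF that(2)] by (elim disjE) (simp_all only: S_val U_val, simp_all)
  have less: "S j x < 4" "U j x < 4" if "j < 4" "x < 2" for j x
  proof -
    have "x = 0 \<or> x = 1" using that by auto
    with four[OF that(1)] show "S j x < 4" "U j x < 4"
      by (elim disjE; simp only: S_val U_val; simp)+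
  qed
  define M where "M j = mat (2 * 1) (2 * a)
    (\<lambda>(x, i). if i = e (S j x) then of_real (sqrt (W j) / t (S j x)) else 0 :: complex)" for j
  \<comment> \<open>The diagonal of the sum of the adjoint products of the four \<open>M j\<close>;
    the operator \<open>F\<close> for failure completes it to the identity.\<close>
  define q where "q i = (\<Sum>j<4. \<Sum>x<2. if i = e (S j x) then W j / (t (S j x))\<^sup>2 else 0)" for i
  define F where "F = mat (2 * a) (2 * a) (\<lambda>(i, i'). if i = i' then of_real (sqrt (1 - q i)) else 0 :: complex)"
  have Mc: "M j \<in> carrier_mat (2 * 1) (2 * a)" for j by (simp add: M_def)
  have Fc: "F \<in> carrier_mat (2 * a) (2 * a)" by (simp add: F_def)
  \<comment> \<open>At \<open>e k\<close> the sum collects the weights of the pairs that contain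
    \<open>k\<close>, divided by the square of \<open>t k\<close>, so \<open>deg\<close> bounds it
    by 1. Off the range of \<open>e\<close> it is 0.\<close>
  have q1: "q i \<le> 1" for i
  proof (cases "\<exists>k<4. i = e k")
    case True
    then obtain k where k: "k < 4" "i = e k" by blast
    have "q i = (\<Sum>j<4. \<Sum>x<2. if k = S j x then W j / (t k)\<^sup>2 else 0)"
      unfolding q_def
      using inj_on_eq_iff[OF e(2)] less k by (intro sum.cong refl) auto
    also have "\<dots> \<le> 1"
      using four[OF k(1)] deg t[of 0] t[of 1] t[of 2] t[of 3]
      unfolding sum_lessThan_4 sum_lessThan_2 One_nat_def[symmetric] S_val
      by (elim disjE) (simp_all add: add_divide_distrib[symmetric])
    finally show ?thesis .
  next
    case False
    then have "q i = 0" unfolding q_def using less by (intro sum.neutral ballI) auto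
    then show ?thesis by simp
  qed
  have root: "complex_of_real (sqrt (W j) / y) * complex_of_real (sqrt (W j) / y) = of_real (W j / y\<^sup>2)"
    if "j < 4" for j y
  proof -
    have "sqrt (W j) / y * (sqrt (W j) / y) = W j / y\<^sup>2"
      using W[OF that] by (simp add: power2_eq_square)
    then show ?thesis by (metis of_real_mult)
  qed
  have M_adj: "(mat_adjoint (M j) * M j) $$ (i, i') =
      (if i = i' then of_real (\<Sum>x<2. if i = e (S j x) then W j / (t (S j x))\<^sup>2 else 0) else 0)"
    if "j < 4" "i < 2 * a" "i' < 2 * a" for j i i'
  proof -
    have "(mat_adjoint (M j) * M j) $$ (i, i') = (\<Sum>x<2. cnj (M j $$ (x, i)) * M j $$ (x, i'))"
      using adjoint_mult_index[OF Mc that(2,3)] by simp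
    also have "\<dots> = (\<Sum>x<2. if i = i' then of_real (if i = e (S j x) then W j / (t (S j x))\<^sup>2 else 0) else 0)"
      using that by (intro sum.cong refl) (auto simp: M_def root simp del: of_real_divide)
    finally show ?thesis by simp
  qed
  have F_adj: "(mat_adjoint F * F) $$ (i, i') = (if i = i' then of_real (1 - q i) else 0)"
    if "i < 2 * a" "i' < 2 * a" for i i'
  proof -
    have "(mat_adjoint F * F) $$ (i, i') =
        (\<Sum>x<2 * a. if x = i then (if x = i' then of_real (1 - q i) else 0) else 0)"
      unfolding adjoint_mult_index[OF Fc that]
      using that q1[of i] by (intro sum.cong refl) (auto simp: F_def simp flip: of_real_mult)
    then show ?thesis using that by simp
  qed
  \<comment> \<open>Outcomes 0 to 3 select a pair and pass to Bob; outcome 4 is failure, after which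
    Alice keeps dimension \<open>a\<close> and the protocol stops.\<close>
  define E where "E j = (if j < 4 then [M j] else [F])" for j
  define d where "d j = (if j < 4 then 1 else a)" for j :: nat
  define D where "D j = (if j < 4
    then Bob 1 (\<lambda>_. 1) (\<lambda>_. [select_pair (S j), select_pair (U j)]) (\<lambda>_. Finish) else Finish)" for j
  let ?P = "Alice 5 d E D"
  have inst: "instrument a 5 d E"
  proof -
    let ?Ms = "map (\<lambda>K. mat_adjoint K * K) (concat (map E [0..<5]))"
    have Ms: "?Ms = map (\<lambda>K. mat_adjoint K * K) [M 0, M 1, M 2, M 3, F]"
      by (simp add: E_def upt_rec numeral_2_eq_2 numeral_3_eq_3)
    have car: "set ?Ms \<subseteq> carrier_mat (2 * a) (2 * a)"
      unfolding Ms by (auto intro!: carrier_matI simp: M_def F_def)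
    have "msum (2 * a) ?Ms = 1\<^sub>m (2 * a)"
    proof (rule eq_matI)
      fix i i' assume "i < dim_row (1\<^sub>m (2 * a) :: complex mat)" "i' < dim_col (1\<^sub>m (2 * a) :: complex mat)"
      then have i: "i < 2 * a" "i' < 2 * a" by simp_all
      have "msum (2 * a) ?Ms $$ (i, i') =
          (\<Sum>j<4. (mat_adjoint (M j) * M j) $$ (i, i')) + (mat_adjoint F * F) $$ (i, i')"
        unfolding msum_index[OF car i] unfolding Ms by (simp add: sum_lessThan_4 add.assoc)
      also have "\<dots> = (if i = i' then of_real (q i) + of_real (1 - q i) else 0)"
        using i by (simp add: M_adj F_adj q_def)
      also have "\<dots> = 1\<^sub>m (2 * a) $$ (i, i')" using i by simp
      finally show "msum (2 * a) ?Ms $$ (i, i') = 1\<^sub>m (2 * a) $$ (i, i')" .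
    qed (use msum_carrier[OF car] in auto)
    then show ?thesis
      unfolding instrument_def using a Mc Fc by (auto simp: E_def d_def)
  qed
  have "locc_protocol (D j) (d j) 2" for j
    using instrument_select_pair[OF dist[of j] cover[of j]] by (simp add: D_def d_def)
  then have "locc_protocol ?P a 2" using inst by simp
  moreover have "2 * (W 0 + W 1 + W 2 + W 3) \<le> success_prob ?P a 2 (ketbra (schmidt_vec a e t))"
  proof -
    have branch: "success_prob (D j) (d j) 2 (apply_Alice (d j) 2 (E j) (ketbra (schmidt_vec a e t))) = 2 * W j"
      if j: "j < 4" for j
    proof -
      have "success_prob (Bob 1 (\<lambda>_. 1) (\<lambda>_. [select_pair (S j), select_pair (U j)]) (\<lambda>_. Finish)) 1 2
        (apply_Alice 1 2 [M j] (ketbra (schmidt_vec a e t))) = 2 * W j"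
        by (rule schmidt_pair_branch[OF e t W[OF j] less(1)[OF j] less(2)[OF j] dist[OF j] M_def])
      then show ?thesis using j by (simp only: D_def d_def E_def if_True)
    qed
    \<comment> \<open>The failure leaf is only bounded below by 0, whence the inequality in the
      conclusion.\<close>
    have "0 \<le> success_prob (D 4) (d 4) 2 (apply_Alice (d 4) 2 (E 4) (ketbra (schmidt_vec a e t)))"
    proof -
      have vs: "set [schmidt_vec a e t] \<subseteq> carrier_vec (2 * a * (2 * 2))"
        using schmidt_vec_carrier by simp
      have Fs: "set [F] \<subseteq> carrier_mat (2 * a) (2 * a)" using Fc by simp
      have "apply_Alice a 2 [F] (ketbra (schmidt_vec a e t)) =
          mixture (2 * a * (2 * 2)) [kron F (1\<^sub>m (2 * 2)) *\<^sub>v schmidt_vec a e t]"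
        using apply_Alice_mixture[OF Fs vs] unfolding mixture_single[OF schmidt_vec_carrier]
        by (simp only: list.map concat.simps append.simps)
      moreover have "set [kron F (1\<^sub>m (2 * 2)) *\<^sub>v schmidt_vec a e t] \<subseteq> carrier_vec (2 * a * (2 * 2))"
        using mult_mat_vec_carrier[OF kron_carrier[OF Fc one_carrier_mat] schmidt_vec_carrier] by simp
      ultimately have "0 \<le> success_prob Finish a 2 (apply_Alice a 2 [F] (ketbra (schmidt_vec a e t)))"
        using success_prob_Finish_nonneg by metis
      then show ?thesis by (simp add: D_def d_def E_def del: success_prob.simps(1))
    qed
    moreover have "success_prob ?P a 2 (ketbra (schmidt_vec a e t)) =
      (\<Sum>j<4. success_prob (D j) (d j) 2 (apply_Alice (d j) 2 (E j) (ketbra (schmidt_vec a e t)))) +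
      success_prob (D 4) (d 4) 2 (apply_Alice (d 4) 2 (E 4) (ketbra (schmidt_vec a e t)))"
      using sum.lessThan_Suc[of _ 4] by simp
    moreover have "(\<Sum>j<4. success_prob (D j) (d j) 2 (apply_Alice (d j) 2 (E j) (ketbra (schmidt_vec a e t)))) =
      (\<Sum>j<4. 2 * W j)"
      by (intro sum.cong refl) (simp add: branch)
    ultimately show ?thesis by (simp add: sum_lessThan_4)
  qed
  ultimately show ?thesis by blast
qed

section \<open>The optimal probability for a vector in Schmidt form\<close>

text \<open>The upper bounds come from the total norm and from removing index 0. The pairing
  protocol meets the smaller of the two; \<open>large\<close> ensures that its weights are
  nonnegative when the weight of index 0 is below 1/2.\<close>

lemma optimal_success_prob_schmidt_vec:
  fixes t :: "nat \<Rightarrow> real"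
  assumes e: "\<And>k. k < 4 \<Longrightarrow> e k < 2 * a" "inj_on e {..<4}"
    and t: "\<And>k. k < 4 \<Longrightarrow> t k \<noteq> 0" "(\<Sum>k<4. (t k)\<^sup>2) = 1"
    and large: "1 / 2 \<le> (t 0)\<^sup>2 + (t 1)\<^sup>2" "1 / 2 \<le> (t 0)\<^sup>2 + (t 2)\<^sup>2"
  shows "optimal_success_prob a 2 (ketbra (schmidt_vec a e t)) (min 1 (2 * (1 - (t 0)\<^sup>2)))"
    (is "optimal_success_prob a 2 ?\<rho> ?p")
proof -
  have norm: "(t 0)\<^sup>2 + (t 1)\<^sup>2 + (t 2)\<^sup>2 + (t 3)\<^sup>2 = 1"
    using t(2) by (simp add: sum_lessThan_4)
  have upper: "success_prob P a 2 ?\<rho> \<le> ?p" if P: "locc_protocol P a 2" for P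
  proof -
    have "success_prob P a 2 ?\<rho> \<le> 1"
      using success_prob_le_sq_norm[OF P schmidt_vec_carrier[of a e t]]
        sq_norm_schmidt_vec[OF e(1), where t = t] t(2)
      by simp
    moreover have "sq_norm (schmidt_vec a e (t(0 := 0))) = 1 - (t 0)\<^sup>2"
      using sq_norm_schmidt_vec[OF e(1), where t = "t(0 := 0)"] norm by (simp add: sum_lessThan_4)
    then have "success_prob P a 2 ?\<rho> \<le> 2 * (1 - (t 0)\<^sup>2)"
      using success_prob_le_product_split[OF P product_split_schmidt_vec[where t = t and u = "t(0 := 0)" and e = e]] by simp
    ultimately show ?thesis by simp
  qed
  \<comment> \<open>Ideally index 0 is paired with all the others. If its weight is below 1/2 it
    cannot absorb them, and moving \<open>w\<close> onto the pair {1,2} lowers the demand on index 0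
    by \<open>2 * w\<close>; this is the least \<open>w\<close> for which that demand fits.\<close>
  define w where "w = max 0 (1 / 2 - (t 0)\<^sup>2)"
  define W where "W = (!) [(t 3)\<^sup>2, (t 1)\<^sup>2 - w, (t 2)\<^sup>2 - w, w]"
  have W: "W 0 = (t 3)\<^sup>2" "W 1 = (t 1)\<^sup>2 - w" "W 2 = (t 2)\<^sup>2 - w" "W 3 = w"
    by (simp_all add: W_def)
  have w: "0 \<le> w" "w \<le> (t 1)\<^sup>2" "w \<le> (t 2)\<^sup>2" "1 - (t 0)\<^sup>2 - 2 * w \<le> (t 0)\<^sup>2"
    and p: "2 * (1 - (t 0)\<^sup>2 - w) = ?p"
    using large unfolding w_def by (auto simp: max_def min_def)
  have W_nonneg: "0 \<le> W j" if "j < 4" for j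
  proof -
    have "j = 0 \<or> j = 1 \<or> j = 2 \<or> j = 3" using that by auto
    then show ?thesis using w W by auto
  qed
  have "\<exists>P. locc_protocol P a 2 \<and> 2 * (W 0 + W 1 + W 2 + W 3) \<le> success_prob P a 2 ?\<rho>"
    by (rule schmidt_protocol[OF e t(1) W_nonneg]) (use w W norm in simp_all)
  moreover have "2 * (W 0 + W 1 + W 2 + W 3) = ?p"
    unfolding p[symmetric] W using norm by (simp add: algebra_simps)
  \<comment> \<open>The protocol reaches at least \<open>?p\<close> and the upper bound allows no
    more, so its success probability is exactly \<open>?p\<close>.\<close>
  ultimately show ?thesis
    unfolding optimal_success_prob_def using upper by (metis order_antisym)
qed

section \<open>The states of the two models in Schmidt form\<close>

lemma less_32_cases:
  fixes i :: nat
  assumes "i < 32"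
  shows "i \<in> {0, 1, 2, 3, 4, 5, 6, 7, 8, 9, 10, 11, 12, 13, 14, 15, 16, 17, 18, 19, 20, 21, 22, 23, 24, 25, 26, 27, 28, 29, 30, 31}"
proof -
  have "i \<in> {..<32}" using assms by simp
  then show ?thesis by (simp add: lessThan_nat_numeral) blast
qed

lemma psi_ket_index: "psi_ket \<theta> $ k = [of_real (cos \<theta>), 0, 0, of_real (sin \<theta>)] ! k"
  unfolding psi_ket_def by (rule vec_of_list_index)

lemma ghz_ket_index: "ghz_ket \<alpha> \<beta> $ k = [of_real \<alpha>, 0, 0, 0, 0, 0, 0, of_real \<beta>] ! k"
  unfolding ghz_ket_def by (rule vec_of_list_index)

text \<open>Alice's index reads \<open>A A' K\<close> in binary. The bit of \<open>K\<close> copies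
  that of \<open>A'\<close>, so only 000, 011, 100 and 111 occur, that is 0, 3, 4 and 7, matched
  with Bob's \<open>B B'\<close> in the order 00, 01, 10, 11.\<close>

lemma transfer_ket_schmidt:
  "transfer_ket \<theta> \<alpha> \<beta> = schmidt_vec 4 (\<lambda>k. [0, 3, 4, 7] ! k)
     (\<lambda>k. [\<alpha> * cos \<theta>, \<beta> * cos \<theta>, \<alpha> * sin \<theta>, \<beta> * sin \<theta>] ! k)" (is "_ = ?v")
proof (rule eq_vecI)
  fix i assume "i < dim_vec ?v"
  then have "i < 32" by (simp add: schmidt_vec_def)
  from less_32_cases[OF this] show "transfer_ket \<theta> \<alpha> \<beta> $ i = ?v $ i"
    unfolding insert_iff empty_iff
    by (elim disjE)
       (simp_all add: transfer_ket_def schmidt_vec_def initial_amp_def psi_ket_index ghz_ket_index binary_digit_def)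
qed (simp add: transfer_ket_def schmidt_vec_def)

text \<open>The sign of the Bank's outcome, \<open>\<sigma>\<close>, multiplies only the term with
  \<open>A'B'\<close> in 11. The indices \<open>A A'\<close> and \<open>B B'\<close> coincide, so
  \<open>e\<close> is the identity.\<close>

lemma bank_ket_schmidt:
  assumes \<kappa>: "\<kappa> = vec_of_list [of_real (1 / sqrt 2), of_real (\<sigma> / sqrt 2)]"
  shows "bank_ket \<theta> \<alpha> \<beta> \<kappa> = of_real (1 / sqrt 2) \<cdot>\<^sub>v schmidt_vec 2 (\<lambda>k. k)
     (\<lambda>k. [\<alpha> * cos \<theta>, \<sigma> * \<beta> * cos \<theta>, \<alpha> * sin \<theta>, \<sigma> * \<beta> * sin \<theta>] ! k)" (is "_ = ?v")
proof (rule eq_vecI)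
  fix i assume "i < dim_vec ?v"
  then have "i < 16" by (auto simp: schmidt_vec_def)
  then have "i < 32" "i < 16" by simp_all
  from less_32_cases[OF this(1)] this(2) show "bank_ket \<theta> \<alpha> \<beta> \<kappa> $ i = ?v $ i"
    unfolding insert_iff empty_iff
    by (elim disjE)
       (simp_all add: bank_ket_def schmidt_vec_def initial_amp_def psi_ket_index ghz_ket_index binary_digit_def
         \<kappa> sum_lessThan_2)
qed (simp add: bank_ket_def schmidt_vec_def)

text \<open>A scalar \<open>c\<close> multiplies the projector and its trace by the same |c|^2, so
  conditioning on the outcome returns the unit vector.\<close>

lemma normalized_ketbra_smult:
  assumes "v \<in> carrier_vec n" "sq_norm v = 1" "c \<noteq> 0"
  shows "inverse (tr (ketbra (c \<cdot>\<^sub>v v))) \<cdot>\<^sub>m ketbra (c \<cdot>\<^sub>v v) = ketbra v"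
proof -
  define d where "d = c * cnj c"
  have d: "d \<noteq> 0" using assms(3) by (simp add: d_def)
  have kb: "ketbra (c \<cdot>\<^sub>v v) = d \<cdot>\<^sub>m ketbra v"
    by (rule eq_matI) (auto simp: ketbra_def d_def)
  have "tr (d \<cdot>\<^sub>m ketbra v) = d * tr (ketbra v)"
    unfolding tr_def by (simp add: sum_distrib_left ketbra_def)
  also have "tr (ketbra v) = 1"
    using tr_mixture[of "[v]" n] mixture_single[OF assms(1)] assms by simp
  finally show ?thesis
    unfolding kb using d by (intro eq_matI) auto
qed

section \<open>Both models at the given parameters\<close>

theorem mainTheorem7:
  fixes \<theta> \<alpha> \<beta> :: real
  assumes "0 < \<theta>" and "\<theta> \<le> pi / 4"
    and "\<alpha> \<ge> \<beta>" and "\<beta> > 0" and "\<alpha>\<^sup>2 + \<beta>\<^sup>2 = 1"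
  shows "(\<forall>\<kappa> \<in> {plus_ket, minus_ket}.
            optimal_success_prob 2 2 (bank_state \<theta> \<alpha> \<beta> \<kappa>) (P_max_GHZ \<theta> \<alpha>)) \<and>
         optimal_success_prob 4 2 (transfer_state \<theta> \<alpha> \<beta>) (P_max_GHZ \<theta> \<alpha>)"
proof -
  \<comment> \<open>One family covers all three states: \<open>\<sigma> = 1\<close> for the plus
    outcome and for the transfer model, \<open>\<sigma> = -1\<close> for the minus outcome.\<close>
  define t where "t \<sigma> k = [\<alpha> * cos \<theta>, \<sigma> * \<beta> * cos \<theta>, \<alpha> * sin \<theta>, \<sigma> * \<beta> * sin \<theta>] ! k" for \<sigma> :: real and k
  have t_val: "t \<sigma> 0 = \<alpha> * cos \<theta>" "t \<sigma> 1 = \<sigma> * \<beta> * cos \<theta>" "t \<sigma> 2 = \<alpha> * sin \<theta>" "t \<sigma> 3 = \<sigma> * \<beta> * sin \<theta>" for \<sigma>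
    by (simp_all add: t_def)
  have pos: "0 < cos \<theta>" "0 < sin \<theta>"
    using assms pi_gt_zero by (auto intro!: cos_gt_zero sin_gt_zero)
  \<comment> \<open>The range of \<open>\<theta>\<close> enters through the double angle: it makes
    the squared cosine at least 1/2.\<close>
  have "0 \<le> cos (2 * \<theta>)" using assms by (intro cos_ge_zero) auto
  then have c2: "1 / 2 \<le> (cos \<theta>)\<^sup>2" by (simp add: cos_double_cos)
  have "\<beta>\<^sup>2 \<le> \<alpha>\<^sup>2" using assms by (intro power_mono) auto
  then have a2: "1 / 2 \<le> \<alpha>\<^sup>2" using assms(5) by linarith
  have b2: "\<beta>\<^sup>2 = 1 - \<alpha>\<^sup>2" and s2: "(sin \<theta>)\<^sup>2 = 1 - (cos \<theta>)\<^sup>2"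
    using assms by (simp_all add: sin_squared_eq)
  have four: "k = 0 \<or> k = 1 \<or> k = 2 \<or> k = 3" if "k < 4" for k :: nat
    using that by auto
  have nz: "t \<sigma> k \<noteq> 0" if "\<sigma>\<^sup>2 = 1" "k < 4" for \<sigma> k
    using four[OF that(2)]
  proof (elim disjE)
    have "\<sigma> \<noteq> 0" using that(1) by auto
    then show "k = 0 \<Longrightarrow> ?thesis" "k = 1 \<Longrightarrow> ?thesis" "k = 2 \<Longrightarrow> ?thesis" "k = 3 \<Longrightarrow> ?thesis"
      using pos assms by (simp_all only: t_val) simp_all
  qed
  \<comment> \<open>The two sums in \<open>large\<close> are the squares of
    \<open>cos \<theta>\<close> and of \<open>\<alpha>\<close>, each at least 1/2.\<close>
  have sum: "(\<Sum>k<4. (t \<sigma> k)\<^sup>2) = 1"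
    and large: "1 / 2 \<le> (t \<sigma> 0)\<^sup>2 + (t \<sigma> 1)\<^sup>2" "1 / 2 \<le> (t \<sigma> 0)\<^sup>2 + (t \<sigma> 2)\<^sup>2"
    if "\<sigma>\<^sup>2 = 1" for \<sigma>
    unfolding sum_lessThan_4 t_val power_mult_distrib that b2 s2 using c2 a2
    by (simp_all add: algebra_simps)
  have opt: "optimal_success_prob a 2 (ketbra (schmidt_vec a e (t \<sigma>))) (P_max_GHZ \<theta> \<alpha>)"
    if "\<And>k. k < 4 \<Longrightarrow> e k < 2 * a" "inj_on e {..<4}" "\<sigma>\<^sup>2 = 1" for a e \<sigma>
    using optimal_success_prob_schmidt_vec[OF that(1,2) nz[OF that(3)] sum[OF that(3)] large[OF that(3)]]
    by (simp add: P_max_GHZ_def t_val power_mult_distrib)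
  have bank: "optimal_success_prob 2 2 (bank_state \<theta> \<alpha> \<beta> \<kappa>) (P_max_GHZ \<theta> \<alpha>)"
    if \<kappa>: "\<kappa> = vec_of_list [of_real (1 / sqrt 2), of_real (\<sigma> / sqrt 2)]" and \<sigma>: "\<sigma>\<^sup>2 = 1" for \<kappa> \<sigma>
  proof -
    have ket: "bank_ket \<theta> \<alpha> \<beta> \<kappa> = of_real (1 / sqrt 2) \<cdot>\<^sub>v schmidt_vec 2 (\<lambda>k. k) (t \<sigma>)"
      unfolding bank_ket_schmidt[OF \<kappa>] t_def[abs_def] ..
    have "bank_state \<theta> \<alpha> \<beta> \<kappa> = ketbra (schmidt_vec 2 (\<lambda>k. k) (t \<sigma>))"
      unfolding bank_state_def ket
      by (rule normalized_ketbra_smult[OF schmidt_vec_carrier])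
         (simp_all add: sq_norm_schmidt_vec sum[OF \<sigma>])
    then show ?thesis using opt[of "\<lambda>k. k" 2, OF _ _ \<sigma>] by simp
  qed
  have "optimal_success_prob 2 2 (bank_state \<theta> \<alpha> \<beta> plus_ket) (P_max_GHZ \<theta> \<alpha>)"
    by (rule bank[of _ 1]) (simp_all add: plus_ket_def)
  moreover have "optimal_success_prob 2 2 (bank_state \<theta> \<alpha> \<beta> minus_ket) (P_max_GHZ \<theta> \<alpha>)"
    by (rule bank[of _ "- 1"]) (simp_all add: minus_ket_def)
  moreover have "optimal_success_prob 4 2 (transfer_state \<theta> \<alpha> \<beta>) (P_max_GHZ \<theta> \<alpha>)"
  proof -
    define e where "e k = [0, 3, 4, 7::nat] ! k" for k
    have e: "e 0 = 0" "e 1 = 3" "e 2 = 4" "e 3 = 7" by (simp_all add: e_def)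
    have "transfer_state \<theta> \<alpha> \<beta> = ketbra (schmidt_vec 4 e (t 1))"
      unfolding transfer_state_def transfer_ket_schmidt by (simp add: e_def[abs_def] t_def[abs_def])
    moreover have "inj_on e {..<4}"
    proof (rule inj_onI)
      fix k l assume "k \<in> {..<4}" "l \<in> {..<4}" "e k = e l"
      then show "k = l" using four[of k] four[of l] e by auto
    qed
    moreover have "e k < 2 * 4" if "k < 4" for k
      using four[OF that] e by auto
    ultimately show ?thesis using opt[of e 4 1] by simp
  qed
  ultimately show ?thesis by simp
qed

end
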